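(* No finite non-nilpotent group has a self-complementary nilpotent graph; that is, for every finite non-nilpotent group $G$, the graph $\Gamma_{\mathfrak N}(G)$ is not isomorphic to its complement.
   Context: For a finite group $G$, $\mathrm{nil}(G)=\{g\in G:\langle g,h\rangle \text{ is nilpotent for all } h\in G\}$. For a finite non-nilpotent group $G$, the nilpotent graph $\Gamma_{\mathfrak N}(G)$ is the simple undirected graph with vertex set $G-\mathrm{nil}(G)$ (set difference) in which two distinct vertices $g,h$ are adjacent if and only if $\langle g,h\rangle$ is nilpotent. The complement of a graph has the same vertices, and two distinct vertices are adjacent in it if and only if they are not adjacent in the original graph. *)

theory Defs
  imports
    "HOL-Algebra.Generated_Groups"
    "Graph_Theory.Pair_Digraph"
    "Graph_Theory.Digraph_Isomorphism"
begin

section \<open>Nilpotent groups\<close>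

definition commutator_subgroup :: "('a, 'b) monoid_scheme \<Rightarrow> 'a set \<Rightarrow> 'a set \<Rightarrow> 'a set" where
  "commutator_subgroup G H K =
     generate G (\<Union>h \<in> H. \<Union>k \<in> K. {h \<otimes>\<^bsub>G\<^esub> k \<otimes>\<^bsub>G\<^esub> inv\<^bsub>G\<^esub> h \<otimes>\<^bsub>G\<^esub> inv\<^bsub>G\<^esub> k})"

lemma commutator_subgroup_self: "commutator_subgroup G H H = derived G H"
  by (simp add: commutator_subgroup_def derived_def)

text \<open>Indexed from 0, so that the term with index 0 is the whole group.\<close>

primrec lower_central_series :: "('a, 'b) monoid_scheme \<Rightarrow> nat \<Rightarrow> 'a set" where
  "lower_central_series G 0 = carrier G"
| "lower_central_series G (Suc n) =
     commutator_subgroup G (lower_central_series G n) (carrier G)"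

definition nilpotent_group :: "('a, 'b) monoid_scheme \<Rightarrow> bool" where
  "nilpotent_group G \<longleftrightarrow> group G \<and> (\<exists>n. lower_central_series G n = {\<one>\<^bsub>G\<^esub>})"

section \<open>The nilpotent graph\<close>

abbreviation generates_nilpotent :: "('a, 'b) monoid_scheme \<Rightarrow> 'a \<Rightarrow> 'a \<Rightarrow> bool" where
  "generates_nilpotent G g h \<equiv> nilpotent_group (G\<lparr>carrier := generate G {g, h}\<rparr>)"

definition nil :: "('a, 'b) monoid_scheme \<Rightarrow> 'a set" where
  "nil G = {g \<in> carrier G. \<forall>h \<in> carrier G. generates_nilpotent G g h}"

text \<open>Simple undirected graphs are symmetric loop-free digraphs without parallel arcs
  (\<^locale>\<open>pair_graph\<close>): an edge between \<open>g\<close> and \<open>h\<close> is the pair of arcs \<open>(g, h)\<close>, \<open>(h, g)\<close>.\<close>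

definition nilpotent_graph :: "('a, 'b) monoid_scheme \<Rightarrow> 'a pair_pre_digraph" where
  "nilpotent_graph G =
     \<lparr>pverts = carrier G - nil G,
      parcs = {(g, h). g \<in> carrier G - nil G \<and> h \<in> carrier G - nil G \<and> g \<noteq> h \<and>
                       generates_nilpotent G g h}\<rparr>"

definition graph_complement :: "'a pair_pre_digraph \<Rightarrow> 'a pair_pre_digraph" where
  "graph_complement \<Gamma> =
     \<lparr>pverts = pverts \<Gamma>,
      parcs = {(u, v). u \<in> pverts \<Gamma> \<and> v \<in> pverts \<Gamma> \<and> u \<noteq> v \<and> (u, v) \<notin> parcs \<Gamma>}\<rparr>"

definition self_complementary :: "'a pair_pre_digraph \<Rightarrow> bool" where
  "self_complementary \<Gamma> \<longleftrightarrow> digraph_iso (with_proj \<Gamma>) (with_proj (graph_complement \<Gamma>))"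

text \<open>\<^const>\<open>digraph_iso\<close> is false on ill-formed digraphs; the following facts show that this
  does not interfere here, and that it is the usual isomorphism of simple graphs.\<close>

lemma pair_graph_nilpotent_graph:
  assumes "finite (carrier G)"
  shows "pair_graph (nilpotent_graph G)"
proof -
  let ?V = "carrier G - nil G"
  have "finite (?V \<times> ?V)" using assms by blast
  then have "finite (parcs (nilpotent_graph G))"
    by (rule rev_finite_subset) (auto simp: nilpotent_graph_def)
  moreover have "sym (parcs (nilpotent_graph G))"
    by (auto simp: nilpotent_graph_def sym_def insert_commute)
  ultimately show ?thesis
    using assms
    by unfold_locales (auto simp: nilpotent_graph_def symmetric_def arcs_ends_def arc_to_ends_def)
qed

lemma pair_graph_graph_complement:
  assumes "pair_graph \<Gamma>"
  shows "pair_graph (graph_complement \<Gamma>)"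
proof -
  interpret pair_graph \<Gamma> by (rule assms)
  have "finite (pverts \<Gamma> \<times> pverts \<Gamma>)" by simp
  then have "finite (parcs (graph_complement \<Gamma>))"
    by (rule rev_finite_subset) (auto simp: graph_complement_def)
  moreover have "sym (parcs (graph_complement \<Gamma>))"
    using arcs_symmetric by (auto simp: graph_complement_def sym_def)
  ultimately show ?thesis
    by unfold_locales (auto simp: graph_complement_def symmetric_def arcs_ends_def arc_to_ends_def)
qed

lemma digraph_iso_with_proj_iff:
  assumes "pair_graph \<Gamma>" "pair_graph \<Delta>"
  shows "digraph_iso (with_proj \<Gamma>) (with_proj \<Delta>) \<longleftrightarrow>
    (\<exists>f. bij_betw f (pverts \<Gamma>) (pverts \<Delta>) \<and>
         (\<forall>u \<in> pverts \<Gamma>. \<forall>v \<in> pverts \<Gamma>. (u, v) \<in> parcs \<Gamma> \<longleftrightarrow> (f u, f v) \<in> parcs \<Delta>))"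
proof -
  interpret G: pair_graph \<Gamma> by (rule assms)
  interpret D: pair_graph \<Delta> by (rule assms)
  show ?thesis
  proof
    assume "digraph_iso (with_proj \<Gamma>) (with_proj \<Delta>)"
    then obtain i where i: "G.digraph_isomorphism i" "with_proj \<Delta> = app_iso i (with_proj \<Gamma>)"
      by (auto simp: digraph_iso_def)
    let ?f = "iso_verts i"
    have eqs: "pverts \<Delta> = ?f ` pverts \<Gamma>" "parcs \<Delta> = iso_arcs i ` parcs \<Gamma>"
      "fst = iso_tail i" "snd = iso_head i"
      using i(2) by (auto simp: with_proj_def app_iso_def)
    have inj: "inj_on ?f (pverts \<Gamma>)"
      using G.digraph_isomorphism_inj_on_verts[OF i(1)] by simp
    have arc: "iso_arcs i a = (?f (fst a), ?f (snd a))" if "a \<in> parcs \<Gamma>" for a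
      using that i(1) eqs(3,4)
      by (intro prod_eqI) (auto simp: G.digraph_isomorphism_def)
    have "(u, v) \<in> parcs \<Gamma> \<longleftrightarrow> (?f u, ?f v) \<in> parcs \<Delta>"
      if uv: "u \<in> pverts \<Gamma>" "v \<in> pverts \<Gamma>" for u v
    proof
      assume "(u, v) \<in> parcs \<Gamma>"
      then show "(?f u, ?f v) \<in> parcs \<Delta>" using arc[of "(u, v)"] eqs(2) by force
    next
      assume "(?f u, ?f v) \<in> parcs \<Delta>"
      then obtain a where a: "a \<in> parcs \<Gamma>" "(?f u, ?f v) = (?f (fst a), ?f (snd a))"
        using arc eqs(2) by fastforce
      then have "u = fst a" "v = snd a"
        using inj uv G.arc_fst_in_verts[OF a(1)] G.arc_snd_in_verts[OF a(1)]
        by (auto dest: inj_onD)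
      then show "(u, v) \<in> parcs \<Gamma>" using a(1) by simp
    qed
    then show "\<exists>f. bij_betw f (pverts \<Gamma>) (pverts \<Delta>) \<and>
         (\<forall>u \<in> pverts \<Gamma>. \<forall>v \<in> pverts \<Gamma>. (u, v) \<in> parcs \<Gamma> \<longleftrightarrow> (f u, f v) \<in> parcs \<Delta>)"
      using inj eqs(1) by (intro exI[of _ ?f]) (auto simp: bij_betw_def)
  next
    assume "\<exists>f. bij_betw f (pverts \<Gamma>) (pverts \<Delta>) \<and>
         (\<forall>u \<in> pverts \<Gamma>. \<forall>v \<in> pverts \<Gamma>. (u, v) \<in> parcs \<Gamma> \<longleftrightarrow> (f u, f v) \<in> parcs \<Delta>)"
    then obtain f where f: "inj_on f (pverts \<Gamma>)" "f ` pverts \<Gamma> = pverts \<Delta>"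
      "\<And>u v. u \<in> pverts \<Gamma> \<Longrightarrow> v \<in> pverts \<Gamma> \<Longrightarrow> (u, v) \<in> parcs \<Gamma> \<longleftrightarrow> (f u, f v) \<in> parcs \<Delta>"
      by (auto simp: bij_betw_def)
    define i where
      "i = \<lparr>iso_verts = f, iso_arcs = map_prod f f, iso_head = snd, iso_tail = fst\<rparr>"
    have sub: "parcs \<Gamma> \<subseteq> pverts \<Gamma> \<times> pverts \<Gamma>"
      by (auto simp: mem_Times_iff dest: G.arc_fst_in_verts G.arc_snd_in_verts)
    have "inj_on (map_prod f f) (parcs \<Gamma>)"
      using map_prod_inj_on[OF f(1) f(1)] sub by (rule inj_on_subset)
    then have "G.digraph_isomorphism i"
      using f(1) G.wf_digraph_axioms by (auto simp: G.digraph_isomorphism_def i_def)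
    moreover have "map_prod f f ` parcs \<Gamma> = parcs \<Delta>"
    proof
      show "map_prod f f ` parcs \<Gamma> \<subseteq> parcs \<Delta>" using sub f(3) by auto
      show "parcs \<Delta> \<subseteq> map_prod f f ` parcs \<Gamma>"
      proof
        fix a assume a: "a \<in> parcs \<Delta>"
        obtain u v where "u \<in> pverts \<Gamma>" "v \<in> pverts \<Gamma>" "a = (f u, f v)"
          using D.arc_fst_in_verts[OF a] D.arc_snd_in_verts[OF a] f(2)
          by (metis imageE prod.collapse)
        then show "a \<in> map_prod f f ` parcs \<Gamma>"
          using a f(3) by (auto intro!: image_eqI[of _ _ "(u, v)"])
      qed
    qed
    then have "with_proj \<Delta> = app_iso i (with_proj \<Gamma>)"
      using f(2) by (simp add: i_def app_iso_def with_proj_def)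
    ultimately show "digraph_iso (with_proj \<Gamma>) (with_proj \<Delta>)"
      by (auto simp: digraph_iso_def)
  qed
qed

end

theory Submission
  imports
    Defs
    "HOL-Algebra.Group_Action"
    "HOL-Algebra.Multiplicative_Group"
    "HOL-Algebra.SndIsomorphismGrp"
    "HOL-Algebra.Sylow"
begin

text \<open>Write \<open>N(x)\<close> for the set of all \<open>y\<close> for which \<open>x\<close> and \<open>y\<close> generate a nilpotent subgroup, and \<open>h\<close>
for the size of \<open>nil G\<close>. A vertex \<open>x\<close> has \<open>|N(x)| - 1 - h\<close> neighbours, so an isomorphism \<open>f\<close> from the
graph to its complement satisfies \<open>|N(x)| + |N(f x)| = |G| + h + 1\<close> for every vertex \<open>x\<close>
(\<open>self_complementary_card_nilpotentizer_sum\<close>). Divisibility properties of the numbers \<open>|N(x)|\<close>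
contradict this equation.

There is a vertex at all, because a finite group in which any two elements generate a nilpotent
subgroup is nilpotent (\<open>nilpotent_group_if_nil_eq_carrier\<close>).

If \<open>nil G\<close> is nontrivial, then so is the center (\<open>center_nontrivial_if_nil_nontrivial\<close>). Multiplication
by a central element \<open>c\<close> maps \<open>nil G\<close> and each \<open>N(x)\<close> to itself, hence the order of \<open>c\<close> divides
\<open>h\<close>, \<open>|G|\<close> and all \<open>|N(x)|\<close>, and by the equation it divides 1. So \<open>nil G\<close> is trivial, and the
equation becomes \<open>|N(x)| + |N(f x)| = |G| + 2\<close>.

If \<open>|G|\<close> is odd, inversion pairs off the nontrivial elements of \<open>N(x)\<close>, so \<open>|N(x)|\<close> and \<open>|N(f x)|\<close>
are odd and their sum is not the odd number \<open>|G| + 2\<close>. If \<open>|G|\<close> is even, the number \<open>|G| - 1\<close> of vertices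
is odd. Since \<open>f\<close> exchanges the vertices with \<open>2|N(x)| < |G| + 2\<close> and those with
\<open>2|N(x)| > |G| + 2\<close>, some vertex satisfies \<open>2|N(x)| = |G| + 2\<close>. The order of \<open>x\<close> divides both \<open>|N(x)|\<close> and
\<open>|G|\<close>, so \<open>x\<close> is an involution and \<open>|G|\<close> is not divisible by 4. Then \<open>N(x)\<close> is the centralizer
of \<open>x\<close>, a subgroup with more than half of the elements of \<open>G\<close>; so \<open>x\<close> is central, hence in \<open>nil G\<close>,
and no vertex (\<open>no_nilpotentizer_of_half_size\<close>).

The nilpotency criterion and the nontriviality of the center both rest on
\<open>center_nontrivial_if_commutes_with_coprime_ord\<close>, a count of conjugacy classes, together with the fact that elements of coprime order commute in a nilpotent group.\<close>

section \<open>Parity of finite sets\<close>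

lemma even_card_if_fixpoint_free_involution:
  assumes "finite S" and "\<And>s. s \<in> S \<Longrightarrow> i s \<in> S" "\<And>s. s \<in> S \<Longrightarrow> i (i s) = s" "\<And>s. s \<in> S \<Longrightarrow> i s \<noteq> s"
  shows "even (card S)"
proof -
  let ?C = "(\<lambda>s. {s, i s}) ` S"
  have union: "\<Union>?C = S" using assms(2) by blast
  have "2 * card ?C = card (\<Union>?C)"
  proof (rule card_partition)
    show "card c = 2" if "c \<in> ?C" for c
      using that assms(4) by (force simp: card_2_iff)
    show "c1 \<inter> c2 = {}" if c: "c1 \<in> ?C" "c2 \<in> ?C" "c1 \<noteq> c2" for c1 c2
    proof -
      obtain s t where st: "s \<in> S" "t \<in> S" "c1 = {s, i s}" "c2 = {t, i t}" using c by blast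
      have "s \<noteq> t" using st c(3) by blast
      moreover have "s \<noteq> i t" using st c(3) assms(3)[of t] by auto
      moreover have "i s \<noteq> t" using st c(3) assms(3)[of s] by auto
      moreover have "i s \<noteq> i t" using assms(3)[OF st(1)] assms(3)[OF st(2)] \<open>s \<noteq> t\<close> by metis
      ultimately show ?thesis using st by blast
    qed
  qed (use assms(1) union in simp_all)
  then show ?thesis unfolding union by (metis dvd_triv_left)
qed

text \<open>The map \<open>f\<close> exchanges the elements whose value lies below \<open>m / 2\<close> and those whose value lies
above.\<close>

lemma even_card_if_values_complementary:
  fixes a :: "'a \<Rightarrow> nat"
  assumes fin: "finite V" and f: "inj_on f V" "f ` V \<subseteq> V"
    and sum: "\<And>x. x \<in> V \<Longrightarrow> a x + a (f x) = m"
    and no_middle: "\<And>x. x \<in> V \<Longrightarrow> 2 * a x \<noteq> m"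
  shows "even (card V)"
proof -
  define L where "L = {x \<in> V. 2 * a x < m}"
  define U where "U = {x \<in> V. m < 2 * a x}"
  have sub: "L \<subseteq> V" "U \<subseteq> V" by (auto simp: L_def U_def)
  have finLU: "finite L" "finite U" using sub fin by (auto intro: finite_subset)
  have V: "V = L \<union> U" using no_middle unfolding L_def U_def by (auto simp: neq_iff)
  have "f x \<in> U" if "x \<in> L" for x using that f(2) sum[of x] by (auto simp: L_def U_def)
  then have "card L \<le> card U"
    by (intro card_inj_on_le[OF inj_on_subset[OF f(1) sub(1)] _ finLU(2)]) blast
  moreover have "f x \<in> L" if "x \<in> U" for x using that f(2) sum[of x] by (auto simp: L_def U_def)
  then have "card U \<le> card L"
    by (intro card_inj_on_le[OF inj_on_subset[OF f(1) sub(2)] _ finLU(1)]) blast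
  moreover have "L \<inter> U = {}" by (auto simp: L_def U_def)
  then have "card V = card L + card U" unfolding V by (rule card_Un_disjoint[OF finLU])
  ultimately show ?thesis by simp
qed

section \<open>Centralizers and the center\<close>

definition centralizer :: "('a, 'b) monoid_scheme \<Rightarrow> 'a set \<Rightarrow> 'a set" where
  "centralizer G S = {g \<in> carrier G. \<forall>s\<in>S. g \<otimes>\<^bsub>G\<^esub> s = s \<otimes>\<^bsub>G\<^esub> g}"

abbreviation center :: "('a, 'b) monoid_scheme \<Rightarrow> 'a set" where
  "center G \<equiv> centralizer G (carrier G)"

context group
begin

lemma inv_mult_cancel_left:
  assumes "g \<in> carrier G" "x \<in> carrier G"
  shows "inv g \<otimes> (g \<otimes> x) = x" "g \<otimes> (inv g \<otimes> x) = x"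
  using assms by (simp_all flip: m_assoc)

lemmas word_simps = m_assoc inv_mult_group inv_mult_cancel_left

lemma subgroup_centralizer:
  assumes "S \<subseteq> carrier G"
  shows "subgroup (centralizer G S) G"
proof (rule subgroupI)
  show "centralizer G S \<noteq> {}"
    using assms by (auto simp: centralizer_def intro!: exI[of _ \<one>])
next
  fix a assume a: "a \<in> centralizer G S"
  show "inv a \<in> centralizer G S"
    unfolding centralizer_def
  proof safe
    show "inv a \<in> carrier G" using a by (simp add: centralizer_def)
    fix s assume "s \<in> S"
    then have s: "s \<in> carrier G" "a \<in> carrier G" "a \<otimes> s = s \<otimes> a"
      using a assms by (auto simp: centralizer_def)
    then have "inv a \<otimes> (a \<otimes> s) \<otimes> inv a = inv a \<otimes> (s \<otimes> a) \<otimes> inv a" by simp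
    then show "inv a \<otimes> s = s \<otimes> inv a"
      using s(1,2) by (simp add: word_simps)
  qed
next
  fix a b assume "a \<in> centralizer G S" "b \<in> centralizer G S"
  then show "a \<otimes> b \<in> centralizer G S"
    using assms by (fastforce simp: centralizer_def subset_iff m_assoc simp flip: m_assoc[of a _ b])
qed (auto simp: centralizer_def)

lemma normal_center: "center G \<lhd> G"
proof (rule normal_invI[OF subgroup_centralizer])
  fix x h assume "x \<in> carrier G" "h \<in> center G"
  then have "x \<in> carrier G" "h \<in> carrier G" "x \<otimes> h = h \<otimes> x" by (auto simp: centralizer_def)
  then have "x \<otimes> h \<otimes> inv x = h" by (simp add: m_assoc)
  then show "x \<otimes> h \<otimes> inv x \<in> center G" using \<open>h \<in> center G\<close> by simp
qed simp

text \<open>Two passages to a centralizer: the generated subgroup lies in the centralizer of \<open>S\<close>, so \<open>S\<close>, and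
then the subgroup that it generates, lies in the centralizer of the generated subgroup.\<close>

lemma generated_elements_commute:
  assumes S: "S \<subseteq> carrier G"
    and comm: "\<And>s t. s \<in> S \<Longrightarrow> t \<in> S \<Longrightarrow> s \<otimes> t = t \<otimes> s"
    and g: "g \<in> generate G S" and h: "h \<in> generate G S"
  shows "g \<otimes> h = h \<otimes> g"
proof -
  have "generate G S \<subseteq> centralizer G S"
    by (rule generate_subgroup_incl[OF _ subgroup_centralizer[OF S]])
      (use S comm in \<open>auto simp: centralizer_def\<close>)
  moreover have gc: "generate G S \<subseteq> carrier G" by (rule generate_incl[OF S])
  ultimately have "S \<subseteq> centralizer G (generate G S)"
    using S by (fastforce simp: centralizer_def)
  then have "generate G S \<subseteq> centralizer G (generate G S)"
    by (rule generate_subgroup_incl) (rule subgroup_centralizer[OF gc])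
  then show ?thesis using g h by (auto simp: centralizer_def)
qed

section \<open>The lower central series\<close>

lemma commutators_in_carrier:
  assumes "A \<subseteq> carrier G" "B \<subseteq> carrier G"
  shows "(\<Union>h\<in>A. \<Union>k\<in>B. {h \<otimes> k \<otimes> inv h \<otimes> inv k}) \<subseteq> carrier G"
  using assms by (auto simp: subset_iff)

lemma commutator_subgroup_is_subgroup:
  assumes "A \<subseteq> carrier G" "B \<subseteq> carrier G"
  shows "subgroup (commutator_subgroup G A B) G"
  unfolding commutator_subgroup_def
  by (rule generate_is_subgroup[OF commutators_in_carrier[OF assms]])

lemma commutator_in_commutator_subgroup:
  assumes "a \<in> A" "b \<in> B"
  shows "a \<otimes> b \<otimes> inv a \<otimes> inv b \<in> commutator_subgroup G A B"
  unfolding commutator_subgroup_def using assms by (intro generate.incl) auto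

lemma commutator_subgroup_leI:
  assumes "subgroup N G"
    and "\<And>a b. a \<in> A \<Longrightarrow> b \<in> B \<Longrightarrow> a \<otimes> b \<otimes> inv a \<otimes> inv b \<in> N"
  shows "commutator_subgroup G A B \<subseteq> N"
  unfolding commutator_subgroup_def
  by (rule generate_subgroup_incl) (use assms in auto)

lemma commutator_subgroup_mono:
  "A \<subseteq> A' \<Longrightarrow> B \<subseteq> B' \<Longrightarrow> commutator_subgroup G A B \<subseteq> commutator_subgroup G A' B'"
  unfolding commutator_subgroup_def by (intro mono_generate) blast

lemma commutator_subgroup_one:
  assumes "B \<subseteq> carrier G"
  shows "commutator_subgroup G {\<one>} B = {\<one>}"
proof
  show "commutator_subgroup G {\<one>} B \<subseteq> {\<one>}"
    by (rule commutator_subgroup_leI[OF triv_subgroup]) (use assms in auto)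
  show "{\<one>} \<subseteq> commutator_subgroup G {\<one>} B"
    unfolding commutator_subgroup_def by (simp add: generate.one)
qed

lemma commutator_subgroup_consistent:
  assumes "subgroup H G" "A \<subseteq> H" "B \<subseteq> H"
  shows "commutator_subgroup (G\<lparr>carrier := H\<rparr>) A B = commutator_subgroup G A B"
proof -
  let ?C = "\<Union>h\<in>A. \<Union>k\<in>B. {h \<otimes> k \<otimes> inv h \<otimes> inv k}"
  have inv_eq: "inv\<^bsub>G\<lparr>carrier := H\<rparr>\<^esub> x = inv x" if "x \<in> A \<or> x \<in> B" for x
    using that assms by (auto simp: m_inv_consistent)
  have "?C \<subseteq> H" using assms by (auto simp: subgroup.m_closed subgroup.m_inv_closed subset_iff)
  then have "generate (G\<lparr>carrier := H\<rparr>) ?C = generate G ?C"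
    by (rule generate_consistent[OF _ assms(1)])
  then show ?thesis unfolding commutator_subgroup_def by (simp add: inv_eq cong: SUP_cong)
qed

lemma lower_central_series_is_subgroup: "subgroup (lower_central_series G n) G"
proof (induction n)
  case (Suc n)
  then show ?case by (simp add: commutator_subgroup_is_subgroup subgroup.subset)
qed (simp add: subgroup_self)

lemma lower_central_series_subgroup_subset:
  assumes "subgroup H G"
  shows "lower_central_series (G\<lparr>carrier := H\<rparr>) n \<subseteq> H"
  using subgroup.subset[OF group.lower_central_series_is_subgroup[OF subgroup_imp_group[OF assms]]]
  by simp

text \<open>This keeps the lower central series of a subgroup inside the ambient group, where the series of
different subgroups can be compared.\<close>

lemma lower_central_series_subgroup_Suc:
  assumes "subgroup H G"
  shows "lower_central_series (G\<lparr>carrier := H\<rparr>) (Suc n) =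
    commutator_subgroup G (lower_central_series (G\<lparr>carrier := H\<rparr>) n) H"
  using commutator_subgroup_consistent[OF assms lower_central_series_subgroup_subset[OF assms]] by simp

lemma lower_central_series_normal: "lower_central_series G n \<lhd> G"
proof (induction n)
  case 0 show ?case by (simp add: normal_self)
next
  case (Suc n)
  let ?L = "lower_central_series G n"
  have sub: "?L \<subseteq> carrier G" using lower_central_series_is_subgroup by (rule subgroup.subset)
  have "generate G (\<Union>h\<in>?L. \<Union>k\<in>carrier G. {h \<otimes> k \<otimes> inv h \<otimes> inv k}) \<lhd> G"
  proof (rule normal_generateI[OF commutators_in_carrier[OF sub]], simp)
    fix c g assume "c \<in> (\<Union>h\<in>?L. \<Union>k\<in>carrier G. {h \<otimes> k \<otimes> inv h \<otimes> inv k})" and g: "g \<in> carrier G"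
    then obtain h k where hk: "h \<in> ?L" "k \<in> carrier G" "c = h \<otimes> k \<otimes> inv h \<otimes> inv k" by auto
    have hc: "h \<in> carrier G" using hk sub by auto
    let ?c = "\<lambda>x. g \<otimes> x \<otimes> inv g"
    have "?c c = ?c h \<otimes> ?c k \<otimes> inv (?c h) \<otimes> inv (?c k)"
      using hc hk(2) g by (simp add: hk(3) word_simps)
    moreover have "?c h \<in> ?L" by (rule normal.inv_op_closed2[OF Suc g hk(1)])
    ultimately show "?c c \<in> (\<Union>h\<in>?L. \<Union>k\<in>carrier G. {h \<otimes> k \<otimes> inv h \<otimes> inv k})"
      using g hk(2) by auto
  qed
  then show ?case by (simp add: commutator_subgroup_def)
qed

end

lemma (in group_hom) commutator_subgroup_img:
  assumes "A \<subseteq> carrier G" "B \<subseteq> carrier G"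
  shows "commutator_subgroup H (h ` A) (h ` B) = h ` commutator_subgroup G A B"
proof -
  have "(\<Union>x\<in>h ` A. \<Union>y\<in>h ` B. {x \<otimes>\<^bsub>H\<^esub> y \<otimes>\<^bsub>H\<^esub> inv\<^bsub>H\<^esub> x \<otimes>\<^bsub>H\<^esub> inv\<^bsub>H\<^esub> y}) =
      h ` (\<Union>x\<in>A. \<Union>y\<in>B. {x \<otimes> y \<otimes> inv x \<otimes> inv y})"
    using assms by (force simp: subset_iff image_iff)
  then show ?thesis
    unfolding commutator_subgroup_def
    by (simp add: generate_img[OF G.commutators_in_carrier[OF assms]])
qed

lemma (in group_hom) nilpotent_group_img:
  assumes "nilpotent_group G"
  shows "nilpotent_group (H\<lparr>carrier := h ` carrier G\<rparr>)"
proof -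
  let ?I = "H\<lparr>carrier := h ` carrier G\<rparr>"
  have sub: "subgroup (h ` carrier G) H" by (rule img_is_subgroup)
  have "lower_central_series ?I n = h ` lower_central_series G n" for n
  proof (induction n)
    case (Suc n)
    show ?case
      unfolding H.lower_central_series_subgroup_Suc[OF sub] Suc
      by (simp add: commutator_subgroup_img subgroup.subset[OF G.lower_central_series_is_subgroup])
  qed simp
  moreover obtain n where "lower_central_series G n = {\<one>}"
    using assms by (auto simp: nilpotent_group_def)
  ultimately have "lower_central_series ?I n = {\<one>\<^bsub>?I\<^esub>}" by simp
  then show ?thesis
    unfolding nilpotent_group_def using H.subgroup_imp_group[OF sub] by blast
qed

context group
begin

section \<open>Nilpotent subgroups and central elements\<close>

lemma central_conjugation:
  assumes "z \<in> center G" "b \<in> carrier G" "y \<in> carrier G"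
  shows "z \<otimes> (b \<otimes> (inv z \<otimes> y)) = b \<otimes> y"
proof -
  have z: "z \<in> carrier G" "z \<otimes> b = b \<otimes> z" using assms by (auto simp: centralizer_def)
  have "z \<otimes> (b \<otimes> (inv z \<otimes> y)) = (z \<otimes> b) \<otimes> (inv z \<otimes> y)" using assms z(1) by (simp add: m_assoc)
  also have "\<dots> = b \<otimes> y" unfolding z(2) using assms z(1) by (simp add: word_simps)
  finally show ?thesis .
qed

lemma commutator_mult_central:
  assumes "h \<in> carrier G" "h' \<in> carrier G" "z \<in> center G" "z' \<in> center G"
  shows "(h \<otimes> z) \<otimes> (h' \<otimes> z') \<otimes> inv (h \<otimes> z) \<otimes> inv (h' \<otimes> z') = h \<otimes> h' \<otimes> inv h \<otimes> inv h'"
proof -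
  have z: "z \<in> carrier G" "z' \<in> carrier G" using assms by (auto simp: centralizer_def)
  have "(h \<otimes> z) \<otimes> (h' \<otimes> z') \<otimes> inv (h \<otimes> z) \<otimes> inv (h' \<otimes> z') =
      h \<otimes> (z \<otimes> ((h' \<otimes> z') \<otimes> (inv z \<otimes> (inv h \<otimes> (inv z' \<otimes> inv h')))))"
    using assms z by (simp add: m_assoc inv_mult_group)
  also have "\<dots> = h \<otimes> (h' \<otimes> (z' \<otimes> (inv h \<otimes> (inv z' \<otimes> inv h'))))"
    using assms z by (subst central_conjugation) (simp_all add: m_assoc)
  also have "\<dots> = h \<otimes> h' \<otimes> inv h \<otimes> inv h'"
    using assms z by (subst central_conjugation) (simp_all add: m_assoc)
  finally show ?thesis .
qed

text \<open>Central factors cancel in commutators, so from index 1 on the lower central series of \<open>K\<close> is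
contained in that of \<open>H\<close>. The case of trivial central factors is the passage to a subgroup
(\<open>nilpotent_subgroup_mono\<close>); the general case lets one multiply a generator by a central element
(\<open>generates_nilpotent_central_mult\<close>).\<close>

lemma nilpotent_if_subset_mult_center:
  assumes H: "subgroup H G" and K: "subgroup K G"
    and KH: "\<And>k. k \<in> K \<Longrightarrow> \<exists>h\<in>H. \<exists>z\<in>center G. k = h \<otimes> z"
    and nil: "nilpotent_group (G\<lparr>carrier := H\<rparr>)"
  shows "nilpotent_group (G\<lparr>carrier := K\<rparr>)"
proof -
  let ?H = "lower_central_series (G\<lparr>carrier := H\<rparr>)" and ?K = "lower_central_series (G\<lparr>carrier := K\<rparr>)"
  have subH: "?H n \<subseteq> carrier G" for n
    using lower_central_series_subgroup_subset[OF H] subgroup.subset[OF H] by blast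
  have step: "?K (Suc n) \<subseteq> ?H (Suc n)"
    if IH: "\<And>a. a \<in> ?K n \<Longrightarrow> \<exists>h\<in>?H n. \<exists>z\<in>center G. a = h \<otimes> z" for n
    unfolding lower_central_series_subgroup_Suc[OF K]
  proof (rule commutator_subgroup_leI)
    show "subgroup (?H (Suc n)) G"
      unfolding lower_central_series_subgroup_Suc[OF H]
      by (rule commutator_subgroup_is_subgroup[OF subH subgroup.subset[OF H]])
    fix a b assume a: "a \<in> ?K n" and b: "b \<in> K"
    obtain h z where hz: "h \<in> ?H n" "z \<in> center G" "a = h \<otimes> z" using IH[OF a] by blast
    obtain h' z' where hz': "h' \<in> H" "z' \<in> center G" "b = h' \<otimes> z'" using KH[OF b] by blast
    have c: "h \<in> carrier G" "h' \<in> carrier G"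
      using hz hz' subH subgroup.subset[OF H] by auto
    have "a \<otimes> b \<otimes> inv a \<otimes> inv b = h \<otimes> h' \<otimes> inv h \<otimes> inv h'"
      unfolding hz(3) hz'(3) by (rule commutator_mult_central[OF c hz(2) hz'(2)])
    then show "a \<otimes> b \<otimes> inv a \<otimes> inv b \<in> ?H (Suc n)"
      unfolding lower_central_series_subgroup_Suc[OF H]
      using commutator_in_commutator_subgroup[OF hz(1) hz'(1)] by simp
  qed
  have le: "?K (Suc n) \<subseteq> ?H (Suc n)" for n
  proof (induction n)
    case 0 show ?case by (rule step) (use KH in simp)
  next
    case (Suc n)
    have one: "\<one> \<in> center G" by (auto simp: centralizer_def)
    show ?case
    proof (rule step)
      fix a assume "a \<in> ?K (Suc n)"
      then have "a \<in> ?H (Suc n)" using Suc by blast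
      moreover have "a = a \<otimes> \<one>" using calculation subH[of "Suc n"] by auto
      ultimately show "\<exists>h\<in>?H (Suc n). \<exists>z\<in>center G. a = h \<otimes> z" using one by blast
    qed
  qed
  obtain n where "?H n = {\<one>}" using nil by (auto simp: nilpotent_group_def)
  then have "?H (Suc n) = {\<one>}"
    unfolding lower_central_series_subgroup_Suc[OF H]
    by (simp add: commutator_subgroup_one subgroup.subset[OF H])
  then have "?K (Suc n) \<subseteq> {\<one>}" using le[of n] by simp
  moreover have "\<one> \<in> ?K (Suc n)"
    unfolding lower_central_series_subgroup_Suc[OF K] commutator_subgroup_def by (rule generate.one)
  ultimately have "?K (Suc n) = {\<one>}" by blast
  then show ?thesis
    unfolding nilpotent_group_def using subgroup_imp_group[OF K] by (auto simp del: lower_central_series.simps)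
qed

lemma nilpotent_subgroup_mono:
  assumes "subgroup H G" "subgroup K G" "K \<subseteq> H" "nilpotent_group (G\<lparr>carrier := H\<rparr>)"
  shows "nilpotent_group (G\<lparr>carrier := K\<rparr>)"
proof (rule nilpotent_if_subset_mult_center[OF assms(1,2) _ assms(4)])
  fix k assume k: "k \<in> K"
  then have "k \<in> H" "k = k \<otimes> \<one>" using assms(2,3) by (auto dest: subgroup.mem_carrier)
  moreover have "\<one> \<in> center G" by (auto simp: centralizer_def)
  ultimately show "\<exists>h\<in>H. \<exists>z\<in>center G. k = h \<otimes> z" by blast
qed

lemma nilpotent_if_commutative:
  assumes H: "subgroup H G" and comm: "\<And>x y. x \<in> H \<Longrightarrow> y \<in> H \<Longrightarrow> x \<otimes> y = y \<otimes> x"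
  shows "nilpotent_group (G\<lparr>carrier := H\<rparr>)"
proof -
  interpret H: group "G\<lparr>carrier := H\<rparr>" by (rule subgroup_imp_group[OF H])
  interpret H: comm_group "G\<lparr>carrier := H\<rparr>"
    by (rule H.group_comm_groupI) (use comm in simp)
  have "lower_central_series (G\<lparr>carrier := H\<rparr>) (Suc 0) = {\<one>\<^bsub>G\<lparr>carrier := H\<rparr>\<^esub>}"
    using H.derived_eq_singleton[of H] by (simp add: commutator_subgroup_self)
  then show ?thesis unfolding nilpotent_group_def using H.is_group by blast
qed

section \<open>Elements of coprime order in nilpotent groups\<close>

text \<open>Since the commutator \<open>c\<close> of \<open>x\<close> and \<open>y\<close> commutes with both of them, the commutator of \<open>x\<^sup>a\<close> and
\<open>y\<close> is \<open>c\<^sup>a\<close> and that of \<open>x\<close> and \<open>y\<^sup>b\<close> is \<open>c\<^sup>b\<close>. So the order of \<open>c\<close> divides both \<open>a\<close> and \<open>b\<close>.\<close>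

lemma commutator_trivial_if_coprime:
  fixes a b :: nat
  assumes x: "x \<in> carrier G" "x [^] a = \<one>" and y: "y \<in> carrier G" "y [^] b = \<one>"
    and ab: "coprime a b"
    and c: "c \<in> carrier G" "c \<otimes> x = x \<otimes> c" "c \<otimes> y = y \<otimes> c"
    and xy: "x \<otimes> y = c \<otimes> (y \<otimes> x)"
  shows "c = \<one>"
proof -
  have cx: "c \<otimes> x [^] n = x [^] n \<otimes> c" and cy: "c \<otimes> y [^] n = y [^] n \<otimes> c" for n :: nat
    using group_commutes_pow[of x c n] group_commutes_pow[of y c n] x y c by simp_all
  have 1: "x [^] n \<otimes> y = c [^] n \<otimes> (y \<otimes> x [^] n)" for n :: nat
  proof (induction n)
    case (Suc n)
    have "x [^] Suc n \<otimes> y = x [^] n \<otimes> (c \<otimes> (y \<otimes> x))" using x y c by (simp add: m_assoc xy)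
    also have "\<dots> = (x [^] n \<otimes> c) \<otimes> (y \<otimes> x)" using x y c by (simp add: m_assoc)
    also have "\<dots> = c \<otimes> (x [^] n \<otimes> y) \<otimes> x" using x y c by (simp add: m_assoc flip: cx)
    also have "\<dots> = (c \<otimes> c [^] n) \<otimes> (y \<otimes> (x [^] n \<otimes> x))" using x y c by (simp add: Suc m_assoc)
    also have "\<dots> = c [^] Suc n \<otimes> (y \<otimes> x [^] Suc n)" using c nat_pow_Suc2[of c n] by simp
    finally show ?case .
  qed (use x y in auto)
  have 2: "x \<otimes> y [^] n = c [^] n \<otimes> (y [^] n \<otimes> x)" for n :: nat
  proof (induction n)
    case (Suc n)
    have "x \<otimes> y [^] Suc n = (x \<otimes> y [^] n) \<otimes> y" using x y c by (simp add: m_assoc)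
    also have "\<dots> = c [^] n \<otimes> ((y [^] n \<otimes> c) \<otimes> (y \<otimes> x))" using x y c by (simp add: Suc m_assoc xy)
    also have "\<dots> = c [^] n \<otimes> ((c \<otimes> y [^] n) \<otimes> (y \<otimes> x))" by (simp add: cy)
    also have "\<dots> = c [^] Suc n \<otimes> (y [^] Suc n \<otimes> x)" using x y c by (simp add: m_assoc)
    finally show ?case .
  qed (use x y in auto)
  have "c [^] a \<otimes> y = \<one> \<otimes> y" using 1[of a] x y c by simp
  then have "c [^] a = \<one>" using y c by (subst (asm) right_cancel) auto
  moreover have "c [^] b \<otimes> x = \<one> \<otimes> x" using 2[of b] x y c by simp
  then have "c [^] b = \<one>" using x c by (subst (asm) right_cancel) auto
  ultimately have "ord c dvd a" "ord c dvd b" using c pow_eq_id by simp_all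
  then have "ord c = 1" using ab by (metis coprime_common_divisor_nat)
  then show ?thesis using c ord_eq_1 by simp
qed

end

text \<open>The preceding lemma in the image of \<open>h\<close>: it is enough that \<open>c\<close> commutes with \<open>x\<close> and \<open>y\<close> modulo
the kernel.\<close>

lemma (in group_hom) commutator_in_kernel_if_coprime:
  fixes a b :: nat
  assumes x: "x \<in> carrier G" "x [^] a = \<one>" and y: "y \<in> carrier G" "y [^] b = \<one>"
    and ab: "coprime a b"
    and c: "c = x \<otimes> y \<otimes> inv x \<otimes> inv y"
    and cx: "h (c \<otimes> x \<otimes> inv c \<otimes> inv x) = \<one>\<^bsub>H\<^esub>"
    and cy: "h (c \<otimes> y \<otimes> inv c \<otimes> inv y) = \<one>\<^bsub>H\<^esub>"
  shows "h c = \<one>\<^bsub>H\<^esub>"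
proof (rule H.commutator_trivial_if_coprime[of "h x" a "h y" b])
  have cc: "c \<in> carrier G" using x y c by simp
  then show "h x \<in> carrier H" "h y \<in> carrier H" "h c \<in> carrier H" using x y by simp_all
  show "h x [^]\<^bsub>H\<^esub> a = \<one>\<^bsub>H\<^esub>" "h y [^]\<^bsub>H\<^esub> b = \<one>\<^bsub>H\<^esub>"
    using x y by (simp_all flip: hom_nat_pow)
  show "coprime a b" by (rule ab)
  have comm: "h c \<otimes>\<^bsub>H\<^esub> h g = h g \<otimes>\<^bsub>H\<^esub> h c"
    if g: "g \<in> carrier G" "h (c \<otimes> g \<otimes> inv c \<otimes> inv g) = \<one>\<^bsub>H\<^esub>" for g
  proof -
    have "c \<otimes> g = (c \<otimes> g \<otimes> inv c \<otimes> inv g) \<otimes> (g \<otimes> c)" using cc g by (simp add: G.word_simps)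
    then have "h (c \<otimes> g) = h (c \<otimes> g \<otimes> inv c \<otimes> inv g) \<otimes>\<^bsub>H\<^esub> h (g \<otimes> c)"
      using cc g(1) by (metis hom_mult G.inv_closed G.m_closed)
    then show ?thesis unfolding g(2) using cc g(1) by simp
  qed
  show "h c \<otimes>\<^bsub>H\<^esub> h x = h x \<otimes>\<^bsub>H\<^esub> h c" by (rule comm[OF x(1) cx])
  show "h c \<otimes>\<^bsub>H\<^esub> h y = h y \<otimes>\<^bsub>H\<^esub> h c" by (rule comm[OF y(1) cy])
  have "x \<otimes> y = c \<otimes> (y \<otimes> x)" using x y by (simp add: c G.word_simps)
  then have "h (x \<otimes> y) = h (c \<otimes> (y \<otimes> x))" by (rule arg_cong)
  then show "h x \<otimes>\<^bsub>H\<^esub> h y = h c \<otimes>\<^bsub>H\<^esub> (h y \<otimes>\<^bsub>H\<^esub> h x)"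
    using cc x(1) y(1) by simp
qed

context group
begin

text \<open>The commutator of \<open>x\<close> and \<open>y\<close> lies in every term of the lower central series: if it lies in
one term, it is central modulo the next one, and then trivial there because the orders are coprime.\<close>

lemma nilpotent_coprime_commute:
  fixes a b :: nat
  assumes nil: "nilpotent_group G"
    and x: "x \<in> carrier G" "x [^] a = \<one>" and y: "y \<in> carrier G" "y [^] b = \<one>"
    and ab: "coprime a b"
  shows "x \<otimes> y = y \<otimes> x"
proof -
  define c where "c = x \<otimes> y \<otimes> inv x \<otimes> inv y"
  have cc: "c \<in> carrier G" using x y by (simp add: c_def)
  have "c \<in> lower_central_series G n" for n
  proof (induction n)
    case (Suc n)
    define N where "N = lower_central_series G (Suc n)"
    interpret N: normal N G unfolding N_def by (rule lower_central_series_normal)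
    interpret f: group_hom G "G Mod N" "\<lambda>g. N #> g"
      by (intro group_hom.intro group_hom_axioms.intro N.r_coset_hom_Mod is_group N.factorgroup_is_group)
    have "c \<otimes> g \<otimes> inv c \<otimes> inv g \<in> N" if "g \<in> carrier G" for g
      unfolding N_def using commutator_in_commutator_subgroup[OF Suc that] by simp
    then have "N #> (c \<otimes> g \<otimes> inv c \<otimes> inv g) = \<one>\<^bsub>G Mod N\<^esub>" if "g \<in> carrier G" for g
      using that by (simp add: coset_join2 N.subgroup_axioms cc)
    then have "N #> c = \<one>\<^bsub>G Mod N\<^esub>"
      using f.commutator_in_kernel_if_coprime[OF x y ab c_def] x y by simp
    then have "N #> c = N" by simp
    then have "c \<in> N" using rcos_self[OF cc N.subgroup_axioms] by simp
    then show ?case by (simp only: N_def)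
  qed (use cc in simp)
  then have "c = \<one>" using nil by (auto simp: nilpotent_group_def)
  moreover have "x \<otimes> y = c \<otimes> (y \<otimes> x)" using x y by (simp add: c_def word_simps)
  ultimately show ?thesis using x y by simp
qed

lemma generates_nilpotent_coprime_commute:
  fixes a b :: nat
  assumes "generates_nilpotent G x y" "x \<in> carrier G" "x [^] a = \<one>" "y \<in> carrier G" "y [^] b = \<one>"
    "coprime a b"
  shows "x \<otimes> y = y \<otimes> x"
proof -
  let ?H = "G\<lparr>carrier := generate G {x, y}\<rparr>"
  interpret H: group ?H
    by (rule subgroup_imp_group[OF generate_is_subgroup]) (use assms in auto)
  have "x \<otimes>\<^bsub>?H\<^esub> y = y \<otimes>\<^bsub>?H\<^esub> x"
    by (rule H.nilpotent_coprime_commute[OF assms(1), of x a y b])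
      (use assms in \<open>auto intro: generate.incl simp flip: nat_pow_consistent\<close>)
  then show ?thesis by simp
qed

lemma generates_nilpotent_commute: "generates_nilpotent G x y \<longleftrightarrow> generates_nilpotent G y x"
  by (simp add: insert_commute)

lemma generates_nilpotent_if_commute:
  assumes "x \<in> carrier G" "y \<in> carrier G" "x \<otimes> y = y \<otimes> x"
  shows "generates_nilpotent G x y"
proof (rule nilpotent_if_commutative)
  have sub: "{x, y} \<subseteq> carrier G" using assms by simp
  then show "subgroup (generate G {x, y}) G" by (rule generate_is_subgroup)
  fix g h assume "g \<in> generate G {x, y}" "h \<in> generate G {x, y}"
  then show "g \<otimes> h = h \<otimes> g"
    by (rule generated_elements_commute[OF sub, rotated]) (use assms in auto)
qed

lemma generates_nilpotent_mono:
  assumes "generates_nilpotent G x y" "x \<in> carrier G" "y \<in> carrier G"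
    "x' \<in> generate G {x, y}" "y' \<in> generate G {x, y}"
  shows "generates_nilpotent G x' y'"
proof (rule nilpotent_subgroup_mono[OF _ _ _ assms(1)])
  show "subgroup (generate G {x, y}) G" by (rule generate_is_subgroup) (use assms in auto)
  then show "generate G {x', y'} \<subseteq> generate G {x, y}"
    by (intro generate_subgroup_incl) (use assms in auto)
  show "subgroup (generate G {x', y'}) G"
    by (rule generate_is_subgroup)
      (use assms generate_in_carrier[of "{x, y}"] in auto)
qed

lemma generates_nilpotent_central_mult:
  assumes "generates_nilpotent G x y" "x \<in> carrier G" "y \<in> carrier G" "z \<in> center G"
  shows "generates_nilpotent G x (z \<otimes> y)"
proof (rule nilpotent_if_subset_mult_center[OF _ _ _ assms(1)])
  let ?H = "generate G {x, y}"
  have zc: "z \<in> carrier G" using assms(4) by (simp add: centralizer_def)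
  show H: "subgroup ?H G" by (rule generate_is_subgroup) (use assms in auto)
  show "subgroup (generate G {x, z \<otimes> y}) G"
    by (rule generate_is_subgroup) (use assms zc in auto)
  have ZH: "subgroup (center G <#> ?H) G"
    using normal_center H
    by (simp add: second_isomorphism_grp.intro second_isomorphism_grp.normal_set_mult_subgroup
        second_isomorphism_grp_axioms.intro)
  have one: "\<one> \<in> center G" by (auto simp: centralizer_def)
  have gens: "x \<in> ?H" "y \<in> ?H" by (simp_all add: generate.incl)
  have "\<one> \<otimes> x \<in> center G <#> ?H" "z \<otimes> y \<in> center G <#> ?H"
    unfolding set_mult_def using one assms(4) gens by blast+
  then have x: "x \<in> center G <#> ?H" and zy: "z \<otimes> y \<in> center G <#> ?H"
    using assms(2) by simp_all
  have "generate G {x, z \<otimes> y} \<subseteq> center G <#> ?H"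
    by (rule generate_subgroup_incl[OF _ ZH]) (use x zy in simp)
  moreover fix k assume "k \<in> generate G {x, z \<otimes> y}"
  ultimately obtain z' h where zh: "z' \<in> center G" "h \<in> ?H" "k = z' \<otimes> h"
    unfolding set_mult_def by blast
  then have "k = h \<otimes> z'" using subgroup.mem_carrier[OF H] by (simp add: centralizer_def)
  then show "\<exists>h\<in>?H. \<exists>z\<in>center G. k = h \<otimes> z" using zh by blast
qed

section \<open>Nontrivial central elements\<close>

text \<open>A set closed under left multiplication by \<open>K\<close> is a disjoint union of right cosets of \<open>K\<close>. All divisibility statements about
nilpotentizers rest on this.\<close>

lemma card_subgroup_dvd_card:
  assumes K: "subgroup K G" and S: "S \<subseteq> carrier G" "finite S"
    and closed: "\<And>k s. k \<in> K \<Longrightarrow> s \<in> S \<Longrightarrow> k \<otimes> s \<in> S"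
  shows "card K dvd card S"
proof -
  let ?C = "(\<lambda>s. K #> s) ` S"
  have cosets: "?C \<subseteq> rcosets K" using S(1) by (auto simp: RCOSETS_def)
  have union: "\<Union>?C = S"
  proof
    show "\<Union>?C \<subseteq> S" using closed unfolding r_coset_def by blast
    show "S \<subseteq> \<Union>?C"
    proof
      fix s assume "s \<in> S"
      moreover then have "s \<in> K #> s" using rcos_self[OF _ K] S(1) by blast
      ultimately show "s \<in> \<Union>?C" by blast
    qed
  qed
  have "card K * card ?C = card (\<Union>?C)"
  proof (rule card_partition)
    show "finite ?C" using S(2) by (rule finite_imageI)
    show "finite (\<Union>?C)" unfolding union by (rule S(2))
    show "card c = card K" if "c \<in> ?C" for c
      using card_rcosets_equal[OF _ subgroup.subset[OF K], of c] that cosets by (metis subsetD)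
    show "c1 \<inter> c2 = {}" if "c1 \<in> ?C" "c2 \<in> ?C" "c1 \<noteq> c2" for c1 c2
      using pairwiseD[OF rcos_disjoint[OF K] _ _ that(3)] that(1,2) cosets
      unfolding disjnt_def by (metis subsetD)
  qed
  then show ?thesis unfolding union by (metis dvd_triv_left)
qed

lemma ord_dvd_card:
  assumes "x \<in> carrier G" "S \<subseteq> carrier G" "finite S"
    and "\<And>k s. k \<in> generate G {x} \<Longrightarrow> s \<in> S \<Longrightarrow> k \<otimes> s \<in> S"
  shows "ord x dvd card S"
  unfolding generate_pow_card[OF assms(1)]
  by (rule card_subgroup_dvd_card) (use assms generate_is_subgroup in auto)

lemma ord_dvd_card_subgroup:
  assumes "x \<in> H" "subgroup H G" "finite H"
  shows "ord x dvd card H"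
proof (rule ord_dvd_card)
  show "x \<in> carrier G" "H \<subseteq> carrier G" "finite H"
    using assms by (auto dest: subgroup.mem_carrier)
  show "k \<otimes> s \<in> H" if "k \<in> generate G {x}" "s \<in> H" for k s
    using that generate_subgroup_incl[of "{x}" H] assms by (auto intro: subgroup.m_closed)
qed

lemma conjugate_pow:
  assumes "g \<in> carrier G" "x \<in> carrier G"
  shows "(g \<otimes> x \<otimes> inv g) [^] (n :: nat) = g \<otimes> x [^] n \<otimes> inv g"
proof (induction n)
  case (Suc n)
  then show ?case using assms by (simp add: word_simps)
qed (use assms in simp)

lemma ord_conjugate:
  assumes "g \<in> carrier G" "x \<in> carrier G"
  shows "ord (g \<otimes> x \<otimes> inv g) = ord x"
proof -
  have "g \<otimes> x [^] n \<otimes> inv g = \<one> \<longleftrightarrow> x [^] n = \<one>" for n :: nat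
  proof
    assume "g \<otimes> x [^] n \<otimes> inv g = \<one>"
    then have "inv g \<otimes> (g \<otimes> x [^] n \<otimes> inv g) \<otimes> g = inv g \<otimes> \<one> \<otimes> g" by simp
    then show "x [^] n = \<one>" using assms by (simp add: word_simps)
  qed (use assms in simp)
  then show ?thesis using assms by (simp add: ord_unique conjugate_pow pow_eq_id)
qed

text \<open>The size \<open>k\<close> of the conjugacy class is the index of the centralizer of \<open>d\<close>. For a prime \<open>q \<noteq> p\<close>,
a Sylow \<open>q\<close>-subgroup consists of elements of order coprime to \<open>p\<close> and so lies in this centralizer;
hence \<open>q\<close> does not divide \<open>k\<close>. If \<open>p\<close> does not divide it either, then \<open>k = 1\<close>.\<close>

lemma central_if_not_dvd_conjugacy_class_card:
  assumes fin: "finite (carrier G)" and p: "prime (p :: nat)" and d: "d \<in> carrier G"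
    and comm: "\<And>y. y \<in> carrier G \<Longrightarrow> coprime p (ord y) \<Longrightarrow> d \<otimes> y = y \<otimes> d"
    and np: "\<not> p dvd card (orbit G (\<lambda>g. \<lambda>h\<in>carrier G. g \<otimes> h \<otimes> inv g) d)"
  shows "d \<in> center G"
proof -
  let ?\<phi> = "\<lambda>g. \<lambda>h\<in>carrier G. g \<otimes> h \<otimes> inv g"
  let ?k = "card (orbit G ?\<phi> d)"
  let ?C = "stabilizer G ?\<phi> d"
  interpret act: group_action G "carrier G" ?\<phi> by (rule action_by_conjugation)
  have stab: "g \<in> ?C \<longleftrightarrow> g \<in> carrier G \<and> g \<otimes> d = d \<otimes> g" for g
    using d inv_solve_right'[of d "g \<otimes> d" g] unfolding stabilizer_def by auto
  have C: "subgroup ?C G" by (rule act.stabilizer_subgroup[OF d])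
  have index: "?k * card ?C = order G" by (rule act.orbit_stabilizer_theorem[OF d])
  have pos: "order G \<noteq> 0" using fin order_gt_0_iff_finite by simp
  have finC: "finite ?C" using fin subgroup.subset[OF C] by (rule finite_subset[rotated])
  have "?k = 1"
  proof (rule ccontr)
    assume "?k \<noteq> 1"
    then obtain q where q: "prime q" "q dvd ?k" using prime_factor_nat by blast
    have "q \<noteq> p" using q np by blast
    obtain m where m: "order G = q ^ multiplicity q (order G) * m" "\<not> q dvd m"
      using multiplicity_decompose'[OF pos, of q] not_prime_unit[of q] q(1) by blast
    obtain H where H: "subgroup H G" "card H = q ^ multiplicity q (order G)"
      using sylow_thm[OF q(1) is_group m(1) fin] by blast
    have finH: "finite H" using fin subgroup.subset[OF H(1)] by (rule finite_subset[rotated])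
    have "H \<subseteq> ?C"
    proof
      fix h assume h: "h \<in> H"
      then have hc: "h \<in> carrier G" using H(1) by (rule subgroup.mem_carrier[rotated])
      have "coprime p (q ^ multiplicity q (order G))"
        using p q(1) \<open>q \<noteq> p\<close> by (simp add: primes_coprime)
      then have "coprime p (ord h)"
        by (rule coprime_divisors[OF dvd_refl ord_dvd_card_subgroup[OF h H(1) finH, unfolded H(2)]])
      then show "h \<in> ?C" unfolding stab using comm[OF hc] hc by simp
    qed
    then have "card H dvd card ?C"
      by (intro card_subgroup_dvd_card[OF H(1) subgroup.subset[OF C] finC] subgroup.m_closed[OF C])
        blast+
    then have "q * card H dvd ?k * card ?C" using q(2) by (rule mult_dvd_mono[rotated])
    then have "q ^ multiplicity q (order G) * q dvd q ^ multiplicity q (order G) * m"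
      using m(1) by (simp only: index H(2) mult.commute[of q])
    then have "q dvd m" using q(1) by (simp add: prime_gt_0_nat)
    then show False using m(2) by contradiction
  qed
  then have "card ?C = card (carrier G)" using index by (simp add: order_def)
  then have "?C = carrier G" by (rule card_subset_eq[OF fin subgroup.subset[OF C]])
  then have "s \<otimes> d = d \<otimes> s" if "s \<in> carrier G" for s using stab[of s] that by simp
  then show ?thesis using d by (simp add: centralizer_def)
qed

text \<open>Let \<open>D\<close> be the centralizer of the set of all elements of order coprime to \<open>p\<close>. It is a union of
conjugacy classes, and \<open>p\<close> divides its size because \<open>a\<close> lies in it. The class of \<open>\<one>\<close> contributes
1, so the size of some other class in \<open>D\<close> is not divisible by \<open>p\<close>, and the elements of that class
are central.\<close>

lemma center_nontrivial_if_commutes_with_coprime_ord: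
  assumes fin: "finite (carrier G)" and p: "prime (p :: nat)"
    and a: "a \<in> carrier G" "p dvd ord a"
    and comm: "\<And>y. y \<in> carrier G \<Longrightarrow> coprime p (ord y) \<Longrightarrow> a \<otimes> y = y \<otimes> a"
  obtains c where "c \<in> center G" "c \<noteq> \<one>"
proof -
  let ?\<phi> = "\<lambda>g. \<lambda>h\<in>carrier G. g \<otimes> h \<otimes> inv g"
  interpret act: group_action G "carrier G" ?\<phi> by (rule action_by_conjugation)
  let ?P = "{y \<in> carrier G. coprime p (ord y)}"
  define D where "D = centralizer G ?P"
  let ?O = "orbits G (carrier G) ?\<phi>"
  have D: "subgroup D G" unfolding D_def by (rule subgroup_centralizer) auto
  have finD: "finite D" using fin subgroup.subset[OF D] by (rule finite_subset[rotated])
  have aD: "a \<in> D" using a(1) comm by (simp add: D_def centralizer_def)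
  have pD: "p dvd card D" by (rule dvd_trans[OF a(2) ord_dvd_card_subgroup[OF aD D finD]])
  have conj: "g \<otimes> d \<otimes> inv g \<in> D" if g: "g \<in> carrier G" and d: "d \<in> D" for g d
    unfolding D_def centralizer_def
  proof safe
    have dc: "d \<in> carrier G" using d by (simp add: D_def centralizer_def)
    then show "g \<otimes> d \<otimes> inv g \<in> carrier G" using g by simp
    fix y assume y: "y \<in> carrier G" "coprime p (ord y)"
    have "inv g \<otimes> y \<otimes> g \<in> ?P"
      using ord_conjugate[of "inv g" y] y g by simp
    then have "d \<otimes> (inv g \<otimes> y \<otimes> g) = (inv g \<otimes> y \<otimes> g) \<otimes> d" using d by (simp add: D_def centralizer_def)
    then have "g \<otimes> (d \<otimes> (inv g \<otimes> y \<otimes> g)) \<otimes> inv g = g \<otimes> ((inv g \<otimes> y \<otimes> g) \<otimes> d) \<otimes> inv g" by simp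
    then show "g \<otimes> d \<otimes> inv g \<otimes> y = y \<otimes> (g \<otimes> d \<otimes> inv g)"
      using g y dc by (simp add: word_simps)
  qed
  have orbit_D: "orbit G ?\<phi> d \<subseteq> D" if "d \<in> D" for d
    using conj[OF _ that] subgroup.mem_carrier[OF D that] by (auto simp: orbit_def)
  have orbit_one: "orbit G ?\<phi> \<one> = {\<one>}" by (auto simp: orbit_def intro!: exI[of _ \<one>])
  have one_D: "\<one> \<in> D" using D by (rule subgroup.one_closed)
  have finO: "finite ?O" using fin by (simp add: orbits_def)
  have sum: "(\<Sum>R\<in>?O. card (R \<inter> D)) = card D"
  proof -
    have restrict: "card (R \<inter> D) = (\<Sum>x\<in>R. if x \<in> D then 1 else 0)" if "finite R" for R :: "'a set"
      unfolding card_eq_sum by (rule sum.inter_restrict[OF that])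
    have "finite R" if "R \<in> ?O" for R
      using that act.orbits_coverture by (intro finite_subset[OF _ fin]) blast
    then have "(\<Sum>R\<in>?O. card (R \<inter> D)) = (\<Sum>R\<in>?O. \<Sum>x\<in>R. if x \<in> D then 1 else 0)"
      by (intro sum.cong refl restrict)
    also have "\<dots> = (\<Sum>x\<in>carrier G. if x \<in> D then 1 else 0)"
      by (rule act.disjoint_sum[OF fin])
    also have "\<dots> = card (carrier G \<inter> D)" by (rule restrict[OF fin, symmetric])
    also have "carrier G \<inter> D = D" using subgroup.subset[OF D] by blast
    finally show ?thesis .
  qed
  have "{\<one>} \<in> ?O" using orbit_one by (auto simp: orbits_def)
  then have "card D = 1 + (\<Sum>R\<in>?O - {{\<one>}}. card (R \<inter> D))"
    using sum.remove[OF finO, of "{\<one>}" "\<lambda>R. card (R \<inter> D)"] one_D unfolding sum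
    by (simp del: One_nat_def)
  then have "\<not> p dvd (\<Sum>R\<in>?O - {{\<one>}}. card (R \<inter> D))"
    using pD not_prime_unit[of p] p dvd_add_left_iff[of p _ 1] by (simp only:) blast
  then obtain R where R: "R \<in> ?O" "R \<noteq> {\<one>}" "\<not> p dvd card (R \<inter> D)"
    using dvd_sum[of "?O - {{\<one>}}" p "\<lambda>R. card (R \<inter> D)"] by blast
  then have "R \<inter> D \<noteq> {}" by auto
  then obtain d where d: "d \<in> R" "d \<in> D" by blast
  obtain e where e: "e \<in> carrier G" "R = orbit G ?\<phi> e" using R(1) by (auto simp: orbits_def)
  have dc: "d \<in> carrier G" using d(2) by (simp add: D_def centralizer_def)
  have "d \<in> orbit G ?\<phi> d" using dc by (rule act.orbit_refl)
  then have R_eq: "R = orbit G ?\<phi> d"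
    using act.disjoint_union[OF R(1), of "orbit G ?\<phi> d"] d(1) dc unfolding orbits_def by blast
  then have "\<not> p dvd card (orbit G ?\<phi> d)" using R(3) orbit_D[OF d(2)] by (simp add: Int_absorb2)
  then have "d \<in> center G"
    by (intro central_if_not_dvd_conjugacy_class_card[OF fin p dc]) (use d(2) in \<open>auto simp: D_def centralizer_def\<close>)
  moreover have "d \<noteq> \<one>" using R(2) R_eq orbit_one by auto
  ultimately show ?thesis by (rule that)
qed

section \<open>Groups all of whose pairs generate nilpotent subgroups\<close>

lemma nil_iff: "g \<in> nil G \<longleftrightarrow> g \<in> carrier G \<and> (\<forall>h\<in>carrier G. generates_nilpotent G g h)"
  by (simp add: nil_def)

lemma nil_pow:
  assumes "g \<in> nil G"
  shows "g [^] (n :: nat) \<in> nil G"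
  unfolding nil_iff
proof safe
  have g: "g \<in> carrier G" using assms by (simp add: nil_iff)
  then show "g [^] n \<in> carrier G" by simp
  fix h assume h: "h \<in> carrier G"
  have "subgroup (generate G {g, h}) G" by (rule generate_is_subgroup) (use g h in simp)
  then have "g [^] n \<in> generate G {g, h}"
    by (induction n) (simp_all add: generate.incl subgroup.m_closed subgroup.one_closed)
  then show "generates_nilpotent G (g [^] n) h"
    using generates_nilpotent_mono[OF _ g h] assms h by (simp add: nil_iff generate.incl)
qed

lemma exists_pow_of_prime_ord:
  assumes "finite (carrier G)" "a \<in> carrier G" "a \<noteq> \<one>"
  obtains p n :: nat where "prime p" "ord (a [^] n) = p"
proof -
  have "ord a \<noteq> 1" using assms ord_eq_1 by simp
  then obtain p where p: "prime p" "p dvd ord a" using prime_factor_nat by blast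
  have "ord a \<noteq> 0" using ord_ge_1[OF assms(1,2)] by simp
  then obtain n where n: "ord a = n * p" "n \<noteq> 0" using p(2) by (metis dvd_div_mult_self mult_eq_0_iff)
  have "ord (a [^] n) = ord a div n" by (rule ord_pow) (use assms n in auto)
  then have "ord (a [^] n) = p" using n by simp
  then show ?thesis using that p(1) by blast
qed

text \<open>A power of \<open>a\<close> has prime order \<open>p\<close> and still lies in \<open>nil G\<close>, so it commutes with all elements of
order coprime to \<open>p\<close>.\<close>

lemma center_nontrivial_if_nil_nontrivial:
  assumes fin: "finite (carrier G)" and a: "a \<in> nil G" "a \<noteq> \<one>"
  obtains c where "c \<in> center G" "c \<noteq> \<one>"
proof -
  have ac: "a \<in> carrier G" using a(1) by (simp add: nil_iff)
  obtain p n :: nat where p: "prime p" "ord (a [^] n) = p"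
    by (rule exists_pow_of_prime_ord[OF fin ac a(2)])
  let ?b = "a [^] n"
  have b: "?b \<in> nil G" by (rule nil_pow[OF a(1)])
  then have bc: "?b \<in> carrier G" by (simp add: nil_iff)
  have comm: "?b \<otimes> y = y \<otimes> ?b" if y: "y \<in> carrier G" "coprime p (ord y)" for y
  proof (rule generates_nilpotent_coprime_commute[OF _ bc _ y(1) _ y(2)])
    show "generates_nilpotent G ?b y" using b y(1) by (simp add: nil_iff)
    show "?b [^] p = \<one>" using pow_ord_eq_1[OF bc] p(2) by simp
    show "y [^] ord y = \<one>" by (rule pow_ord_eq_1[OF y(1)])
  qed
  have "p dvd ord ?b" using p(2) by simp
  then show ?thesis by (rule center_nontrivial_if_commutes_with_coprime_ord[OF fin p(1) bc _ comm that])
qed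

end

lemma (in group_hom) generates_nilpotent_img:
  assumes nil: "generates_nilpotent G x y" and x: "x \<in> carrier G" and y: "y \<in> carrier G"
  shows "generates_nilpotent H (h x) (h y)"
proof -
  let ?K = "generate G {x, y}"
  have K: "subgroup ?K G" by (rule G.generate_is_subgroup) (use x y in simp)
  interpret K: group "G\<lparr>carrier := ?K\<rparr>" by (rule G.subgroup_imp_group[OF K])
  interpret r: group_hom "G\<lparr>carrier := ?K\<rparr>" H h
    by unfold_locales (use subgroup.subset[OF K] in \<open>auto simp: hom_def subset_iff\<close>)
  have "h ` ?K = generate H {h x, h y}" using generate_img[of "{x, y}"] x y by simp
  then show ?thesis using r.nilpotent_group_img[OF nil] by simp
qed

context group
begin

text \<open>For a term of the upper central series of \<open>G\<close> in place of \<open>N\<close>, this is the next term.\<close>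

lemma normal_central_preimage:
  assumes N: "N \<lhd> G"
  shows "{g \<in> carrier G. N #> g \<in> center (G Mod N)} \<lhd> G" (is "?M \<lhd> G")
proof -
  interpret N: normal N G by (rule N)
  interpret f: group_hom G "G Mod N" "\<lambda>g. N #> g"
    by (intro group_hom.intro group_hom_axioms.intro N.r_coset_hom_Mod is_group N.factorgroup_is_group)
  have Z: "subgroup (center (G Mod N)) (G Mod N)" by (rule f.H.subgroup_centralizer) simp
  show ?thesis
  proof (rule normal_invI)
    show "subgroup ?M G"
    proof (rule subgroupI)
      show "?M \<noteq> {}"
        using subgroup.one_closed[OF Z] f.hom_one one_closed
        by (metis (mono_tags, lifting) empty_iff mem_Collect_eq)
      show "inv a \<in> ?M" if "a \<in> ?M" for a
        using that subgroup.m_inv_closed[OF Z] f.hom_inv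
        by (metis (mono_tags, lifting) inv_closed mem_Collect_eq)
      show "a \<otimes> b \<in> ?M" if "a \<in> ?M" "b \<in> ?M" for a b
        using that subgroup.m_closed[OF Z] f.hom_mult
        by (metis (mono_tags, lifting) m_closed mem_Collect_eq)
    qed auto
    fix g m assume g: "g \<in> carrier G" and m: "m \<in> ?M"
    have gm: "N #> (g \<otimes> m \<otimes> inv g) = (N #> g) \<otimes>\<^bsub>G Mod N\<^esub> (N #> m) \<otimes>\<^bsub>G Mod N\<^esub> inv\<^bsub>G Mod N\<^esub> (N #> g)"
      using g m f.hom_mult f.hom_inv by (metis (mono_tags, lifting) inv_closed m_closed mem_Collect_eq)
    have "(N #> g) \<otimes>\<^bsub>G Mod N\<^esub> (N #> m) \<otimes>\<^bsub>G Mod N\<^esub> inv\<^bsub>G Mod N\<^esub> (N #> g) \<in> center (G Mod N)"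
      using normal.inv_op_closed2[OF f.H.normal_center f.hom_closed[OF g]] m by blast
    then show "g \<otimes> m \<otimes> inv g \<in> ?M" using gm g m by simp
  qed
qed

lemma commutators_with_central_preimage:
  assumes N: "N \<lhd> G" and m: "m \<in> carrier G" "N #> m \<in> center (G Mod N)" and g: "g \<in> carrier G"
  shows "m \<otimes> g \<otimes> inv m \<otimes> inv g \<in> N"
proof -
  interpret N: normal N G by (rule N)
  interpret f: group_hom G "G Mod N" "\<lambda>g. N #> g"
    by (intro group_hom.intro group_hom_axioms.intro N.r_coset_hom_Mod is_group N.factorgroup_is_group)
  let ?c = "m \<otimes> g \<otimes> inv m \<otimes> inv g"
  have "(N #> m) \<otimes>\<^bsub>G Mod N\<^esub> (N #> g) = (N #> g) \<otimes>\<^bsub>G Mod N\<^esub> (N #> m)"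
    using m(2) f.hom_closed[OF g] by (simp add: centralizer_def)
  then have eq: "N #> (m \<otimes> g) = N #> (g \<otimes> m)" using f.hom_mult m(1) g by metis
  have mg: "m \<otimes> g \<in> carrier G" "g \<otimes> m \<in> carrier G" using m(1) g by simp_all
  have "?c = (m \<otimes> g) \<otimes> inv (g \<otimes> m)" using m(1) g by (simp add: word_simps)
  then have "N #> ?c = (N #> (m \<otimes> g)) #> inv (g \<otimes> m)"
    by (simp only: coset_mult_assoc[OF N.subset mg(1) inv_closed[OF mg(2)]])
  also have "\<dots> = N #> ((g \<otimes> m) \<otimes> inv (g \<otimes> m))"
    unfolding eq by (rule coset_mult_assoc[OF N.subset mg(2) inv_closed[OF mg(2)]])
  also have "\<dots> = N" by (simp only: r_inv[OF mg(2)] coset_mult_one[OF N.subset])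
  finally have "N #> ?c = N" .
  moreover have "?c \<in> N #> ?c"
    by (rule rcos_self[OF _ N.subgroup_axioms]) (use m(1) g in simp)
  ultimately show ?thesis by (simp only:)
qed

text \<open>Take a normal subgroup \<open>N\<close> that is maximal among those from which iterated commutators with \<open>G\<close>
lead down to the trivial subgroup. If \<open>N\<close> were proper, the quotient would be a nontrivial group
with the same hypothesis, and the preimage of its nontrivial center would be a larger subgroup of this
kind.\<close>

lemma nilpotent_group_if_nil_eq_carrier:
  assumes fin: "finite (carrier G)" and all: "nil G = carrier G"
  shows "nilpotent_group G"
proof -
  let ?F = "\<lambda>A. commutator_subgroup G A (carrier G)"
  define \<N> where "\<N> = {N. N \<lhd> G \<and> (\<exists>n. (?F ^^ n) N = {\<one>})}"
  have sub: "N \<subseteq> carrier G" if "N \<in> \<N>" for N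
    using that by (auto simp: \<N>_def dest: normal_imp_subgroup[THEN subgroup.subset])
  have "{\<one>} \<in> \<N>"
    unfolding \<N>_def using one_is_normal by (auto intro: exI[of _ 0])
  moreover have "finite \<N>"
    by (rule finite_subset[of _ "Pow (carrier G)"]) (use sub fin in auto)
  ultimately obtain N where N: "N \<in> \<N>" and max: "\<And>M. M \<in> \<N> \<Longrightarrow> N \<subseteq> M \<Longrightarrow> N = M"
    using finite_has_maximal[of \<N>] by blast
  obtain n where n: "(?F ^^ n) N = {\<one>}" using N by (auto simp: \<N>_def)
  have "N = carrier G"
  proof (rule ccontr)
    assume "N \<noteq> carrier G"
    then obtain x where x: "x \<in> carrier G" "x \<notin> N" using sub[OF N] by blast
    have normN: "N \<lhd> G" using N by (simp add: \<N>_def)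
    interpret N: normal N G by (rule normN)
    interpret f: group_hom G "G Mod N" "\<lambda>g. N #> g"
      by (intro group_hom.intro group_hom_axioms.intro N.r_coset_hom_Mod is_group N.factorgroup_is_group)
    have in_N: "g \<in> N" if "g \<in> carrier G" "N #> g = N" for g
      using rcos_self[OF that(1) N.subgroup_axioms] that(2) by simp
    have "generates_nilpotent (G Mod N) (N #> x) Y" if "Y \<in> carrier (G Mod N)" for Y
    proof -
      obtain y where y: "y \<in> carrier G" "Y = N #> y" using \<open>Y \<in> _\<close> by (auto simp: carrier_FactGroup)
      have "x \<in> nil G" unfolding all by (rule x(1))
      then have "generates_nilpotent G x y" using y(1) unfolding nil_iff by blast
      then show ?thesis unfolding y(2) using x(1) y(1) by (rule f.generates_nilpotent_img)
    qed
    then have "N #> x \<in> nil (G Mod N)" using f.hom_closed[OF x(1)] by (simp add: f.H.nil_iff)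
    moreover have "N #> x \<noteq> \<one>\<^bsub>G Mod N\<^esub>" using in_N[OF x(1)] x(2) by auto
    moreover have "finite (carrier (G Mod N))" using fin by (simp add: carrier_FactGroup)
    ultimately obtain C where C: "C \<in> center (G Mod N)" "C \<noteq> \<one>\<^bsub>G Mod N\<^esub>"
      using f.H.center_nontrivial_if_nil_nontrivial by blast
    then obtain g where g: "g \<in> carrier G" "C = N #> g" by (auto simp: centralizer_def carrier_FactGroup)
    define M where "M = {g \<in> carrier G. N #> g \<in> center (G Mod N)}"
    have "?F M \<subseteq> N"
      by (rule commutator_subgroup_leI[OF N.subgroup_axioms])
        (auto simp: M_def intro: commutators_with_central_preimage[OF normN])
    \<comment> \<open>Monotonicity: one step takes \<open>M\<close> into \<open>N\<close>, and \<open>n\<close> more steps reach the trivial subgroup.\<close>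
    then have "(?F ^^ k) (?F M) \<subseteq> (?F ^^ k) N" for k
      by (induction k) (simp_all add: commutator_subgroup_mono)
    then have "(?F ^^ Suc n) M \<subseteq> {\<one>}" unfolding funpow_Suc_right n[symmetric] by simp
    moreover have "\<one> \<in> (?F ^^ Suc n) M"
      unfolding funpow.simps comp_def commutator_subgroup_def by (rule generate.one)
    ultimately have "(?F ^^ Suc n) M = {\<one>}" by blast
    then have "M \<in> \<N>"
      unfolding \<N>_def M_def using normal_central_preimage[OF normN] by blast
    moreover have "N \<subseteq> M"
    proof
      fix a assume a: "a \<in> N"
      then have "N #> a = \<one>\<^bsub>G Mod N\<^esub>" by (simp add: N.rcos_const)
      then show "a \<in> M" using a f.H.subgroup_centralizer[of "carrier (G Mod N)"]
        by (auto simp: M_def subgroup.one_closed simp del: one_FactGroup)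
    qed
    ultimately have "N = M" by (rule max)
    moreover have "g \<in> M" using g C(1) by (simp add: M_def)
    ultimately have "g \<in> N" by blast
    then show False using C(2) g(2) by (simp add: N.rcos_const)
  qed
  moreover have "(?F ^^ n) (carrier G) = lower_central_series G n" by (induction n) simp_all
  ultimately show ?thesis using n is_group unfolding nilpotent_group_def by auto
qed

section \<open>Involutions in groups of order not divisible by 4\<close>

lemma four_dvd_order_if_commuting_involutions:
  assumes x: "x \<in> carrier G" "x \<otimes> x = \<one>" "x \<noteq> \<one>"
    and s: "s \<in> carrier G" "s \<otimes> s = \<one>" "s \<noteq> \<one>"
    and comm: "s \<otimes> x = x \<otimes> s" and "s \<noteq> x"
  shows "4 dvd order G"
proof -
  let ?K = "{\<one>, x, s, x \<otimes> s}"
  have left: "x \<otimes> (x \<otimes> y) = y" "s \<otimes> (s \<otimes> y) = y" "s \<otimes> (x \<otimes> y) = x \<otimes> (s \<otimes> y)" if "y \<in> carrier G" for y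
    using that x s comm by (simp_all flip: m_assoc)
  have inv: "inv x = x" "inv s = s" using x s inv_equality by blast+
  have K: "subgroup ?K G"
  proof (rule subgroupI)
    show "inv a \<in> ?K" if "a \<in> ?K" for a
      using that x(1) s(1) comm by (auto simp: inv inv_mult_group)
    show "a \<otimes> b \<in> ?K" if "a \<in> ?K" "b \<in> ?K" for a b
      using that x s comm left by (auto simp: m_assoc)
  qed (use x s in auto)
  have "x \<otimes> s \<noteq> \<one>" using inv_equality[of x s] x(1) s(1) inv(2) \<open>s \<noteq> x\<close> by auto
  moreover have "x \<otimes> s \<noteq> x" "x \<otimes> s \<noteq> s" using x s by simp_all
  ultimately have "card ?K = 4" using x(3) s(3) \<open>s \<noteq> x\<close> by simp
  then show ?thesis using lagrange[OF K] by (metis dvd_triv_right)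
qed

text \<open>Let \<open>r\<close> be the product of \<open>x\<close> and its conjugate \<open>t\<close> by \<open>y\<close>; conjugation by \<open>x\<close> inverts \<open>r\<close>. If the order
of \<open>r\<close> is odd, \<open>x\<close> commutes with \<open>r\<close>, so \<open>r\<close> equals its inverse and is trivial, that is, \<open>t = x\<close>. If it
is even, some power of \<open>r\<close> is an involution that commutes with \<open>x\<close>; it equals \<open>x\<close>, since 4 does
not divide the order of the group, and this again forces \<open>r\<close>
to equal its inverse. Then \<open>r = x\<close> and \<open>t = \<one>\<close>, which is impossible.\<close>

lemma involution_commutes_if_generates_nilpotent:
  assumes fin: "finite (carrier G)" and no4: "\<not> 4 dvd order G"
    and x: "x \<in> carrier G" "ord x = 2" and y: "y \<in> carrier G" and nil: "generates_nilpotent G x y"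
  shows "x \<otimes> y = y \<otimes> x"
proof -
  have xx: "x \<otimes> x = \<one>" using pow_ord_eq_1[OF x(1)] x by (simp add: numeral_2_eq_2)
  have x1: "x \<noteq> \<one>" using x(2) by auto
  have invx: "inv x = x" by (rule inv_equality[OF xx x(1) x(1)])
  define t where "t = y \<otimes> x \<otimes> inv y"
  define r where "r = x \<otimes> t"
  have tc: "t \<in> carrier G" using x y by (simp add: t_def)
  have rc: "r \<in> carrier G" using x tc by (simp add: r_def)
  have "inv t = t" using x y by (simp add: t_def word_simps invx)
  then have inverted: "x \<otimes> r \<otimes> inv x = inv r"
    using x(1) tc by (simp add: r_def invx inv_mult_group inv_mult_cancel_left(1)[of x, unfolded invx] m_assoc)
  have comm_imp: "inv r = r" if "x \<otimes> r = r \<otimes> x"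
    using inverted that x(1) rc by (simp add: m_assoc)
  have sub: "subgroup (generate G {x, y}) G" by (rule generate_is_subgroup) (use x y in simp)
  have "x \<in> generate G {x, y}" "y \<in> generate G {x, y}" by (simp_all add: generate.incl)
  then have "r \<in> generate G {x, y}"
    unfolding r_def t_def using sub by (intro subgroup.m_closed[OF sub] subgroup.m_inv_closed[OF sub])
  then have nil_r: "generates_nilpotent G x r"
    using generates_nilpotent_mono[OF nil x(1) y] by (simp add: generate.incl)
  have "r = \<one>"
  proof (cases "even (ord r)")
    case False
    then have "x \<otimes> r = r \<otimes> x"
      using generates_nilpotent_coprime_commute[OF nil_r x(1) pow_ord_eq_1[OF x(1)] rc pow_ord_eq_1[OF rc]] x(2)
      by simp
    then have "inv r = r" by (rule comm_imp)
    then have "r [^] (2::nat) = \<one>" using rc r_inv[OF rc] by (simp add: numeral_2_eq_2)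
    then have "ord r dvd 2" using rc by (simp add: pow_eq_id)
    then have "ord r = 1" using False by (metis prime_nat_iff two_is_prime_nat dvd_refl)
    then show ?thesis using ord_eq_1[OF rc] by simp
  next
    case True
    then obtain k where k: "ord r = 2 * k" by blast
    have "ord r \<noteq> 0" using ord_ge_1[OF fin rc] by simp
    then have k0: "k \<noteq> 0" using k by simp
    define s where "s = r [^] k"
    have sc: "s \<in> carrier G" using rc by (simp add: s_def)
    have "ord s = 2" unfolding s_def using ord_pow[OF rc, of k] k k0 by simp
    then have ss: "s \<otimes> s = \<one>" "s \<noteq> \<one>"
      using pow_ord_eq_1[OF sc] sc by (auto simp: numeral_2_eq_2)
    have "x \<otimes> s \<otimes> inv x = inv s"
      using conjugate_pow[OF x(1) rc, of k] inverted rc by (simp add: s_def nat_pow_inv)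
    also have "inv s = s" by (rule inv_equality[OF ss(1) sc sc])
    finally have "s \<otimes> x = x \<otimes> s" using x(1) sc inv_solve_right'[of s "x \<otimes> s" x] by simp
    then have "s = x"
      using four_dvd_order_if_commuting_involutions[OF x(1) xx x1 sc ss] no4 by blast
    moreover have "r \<otimes> s = s \<otimes> r" unfolding s_def using rc by (metis nat_pow_Suc nat_pow_Suc2)
    ultimately have "inv r = r" using comm_imp by simp
    then have "r [^] (2::nat) = \<one>" using rc r_inv[OF rc] by (simp add: numeral_2_eq_2)
    then have "ord r dvd 2" using rc by (simp add: pow_eq_id)
    \<comment> \<open>The order of \<open>r\<close> is 2, so the involution \<open>s\<close> is \<open>r\<close> itself.\<close>
    then have "k = 1" using k k0 by (auto dest: dvd_imp_le)
    then have "r = x" using \<open>s = x\<close> rc by (simp add: s_def)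
    then have "t = \<one>" using r_def x(1) tc by simp
    then have "inv y \<otimes> (y \<otimes> x \<otimes> inv y) \<otimes> y = inv y \<otimes> \<one> \<otimes> y" by (simp add: t_def)
    then have "x = \<one>" using x(1) y by (simp add: word_simps)
    then show ?thesis using x1 by contradiction
  qed
  then have "(x \<otimes> x) \<otimes> t = x \<otimes> \<one>" using x(1) tc by (simp only: r_def m_assoc)
  then have "t = x" using xx x(1) tc by simp
  then show ?thesis unfolding t_def using x(1) y inv_solve_right'[of x "y \<otimes> x" y] by simp
qed

end

section \<open>Sizes of nilpotentizers\<close>

definition nilpotentizer :: "('a, 'b) monoid_scheme \<Rightarrow> 'a \<Rightarrow> 'a set" where
  "nilpotentizer G x = {y \<in> carrier G. generates_nilpotent G x y}"

context group
begin

text \<open>Multiplying \<open>y\<close> by a power of \<open>x\<close> does not change the subgroup that \<open>x\<close> and \<open>y\<close> generate.\<close>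

lemma ord_dvd_card_nilpotentizer:
  assumes "finite (carrier G)" "x \<in> carrier G"
  shows "ord x dvd card (nilpotentizer G x)"
proof (rule ord_dvd_card)
  show "finite (nilpotentizer G x)" using assms(1) by (simp add: nilpotentizer_def)
  fix k y assume k: "k \<in> generate G {x}" and y: "y \<in> nilpotentizer G x"
  have yc: "y \<in> carrier G" "generates_nilpotent G x y" using y by (simp_all add: nilpotentizer_def)
  have kc: "k \<in> carrier G" by (rule generate_in_carrier[OF _ k]) (use assms(2) in simp)
  have "k \<in> generate G {x, y}" using mono_generate[of "{x}" "{x, y}"] k by blast
  then have "k \<otimes> y \<in> generate G {x, y}" by (rule generate.eng) (simp add: generate.incl)
  then have "generates_nilpotent G x (k \<otimes> y)"
    using generates_nilpotent_mono[OF yc(2) assms(2) yc(1)] by (simp add: generate.incl)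
  then show "k \<otimes> y \<in> nilpotentizer G x" using kc yc(1) by (simp add: nilpotentizer_def)
qed (use assms in \<open>auto simp: nilpotentizer_def\<close>)

lemma generate_central:
  assumes "c \<in> center G" "k \<in> generate G {c}"
  shows "k \<in> center G"
  using generate_subgroup_incl[of "{c}" "center G"] assms subgroup_centralizer[of "carrier G"] by auto

lemma ord_central_dvd_card_nilpotentizer:
  assumes "finite (carrier G)" "x \<in> carrier G" "c \<in> center G"
  shows "ord c dvd card (nilpotentizer G x)"
proof (rule ord_dvd_card)
  show "c \<in> carrier G" using assms(3) by (simp add: centralizer_def)
  show "finite (nilpotentizer G x)" using assms(1) by (simp add: nilpotentizer_def)
  fix k y assume k: "k \<in> generate G {c}" and y: "y \<in> nilpotentizer G x"
  have "k \<in> center G" by (rule generate_central[OF assms(3) k])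
  then show "k \<otimes> y \<in> nilpotentizer G x"
    using y assms(2) generates_nilpotent_central_mult[of x y k]
    by (simp add: nilpotentizer_def centralizer_def)
qed (auto simp: nilpotentizer_def)

lemma ord_central_dvd_card_nil:
  assumes "finite (carrier G)" "c \<in> center G"
  shows "ord c dvd card (nil G)"
proof (rule ord_dvd_card)
  show "c \<in> carrier G" using assms(2) by (simp add: centralizer_def)
  show "finite (nil G)" using assms(1) by (simp add: nil_def)
  fix k y assume k: "k \<in> generate G {c}" and y: "y \<in> nil G"
  have kZ: "k \<in> center G" by (rule generate_central[OF assms(2) k])
  have "generates_nilpotent G (k \<otimes> y) g" if g: "g \<in> carrier G" for g
  proof -
    have "generates_nilpotent G g y" using y g generates_nilpotent_commute[of g y] by (simp add: nil_iff)
    then have "generates_nilpotent G g (k \<otimes> y)"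
      using generates_nilpotent_central_mult[of g y k] g y kZ by (simp add: nil_iff)
    then show ?thesis using generates_nilpotent_commute[of g "k \<otimes> y"] by simp
  qed
  then show "k \<otimes> y \<in> nil G" using y kZ by (simp add: nil_iff centralizer_def)
qed (auto simp: nil_iff)

text \<open>In a group of odd order only \<open>\<one>\<close> is its own inverse.\<close>

lemma odd_card_nilpotentizer:
  assumes fin: "finite (carrier G)" and odd: "odd (order G)" and x: "x \<in> carrier G"
  shows "odd (card (nilpotentizer G x))"
proof -
  have one: "\<one> \<in> nilpotentizer G x"
    using x generates_nilpotent_if_commute[of x \<one>] by (simp add: nilpotentizer_def)
  have finN: "finite (nilpotentizer G x)" using fin by (simp add: nilpotentizer_def)
  have "even (card (nilpotentizer G x - {\<one>}))"
  proof (rule even_card_if_fixpoint_free_involution[where i = "m_inv G"])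
    show "finite (nilpotentizer G x - {\<one>})" using finN by simp
    fix y assume y: "y \<in> nilpotentizer G x - {\<one>}"
    then have yc: "y \<in> carrier G" "generates_nilpotent G x y" "y \<noteq> \<one>" by (auto simp: nilpotentizer_def)
    then show "inv (inv y) = y" by simp
    have "generates_nilpotent G x (inv y)"
      using generates_nilpotent_mono[OF yc(2) x yc(1)] by (simp add: generate.incl generate.inv)
    then show "inv y \<in> nilpotentizer G x - {\<one>}" using yc by (simp add: nilpotentizer_def)
    show "inv y \<noteq> y"
    proof
      assume "inv y = y"
      then have "y [^] (2::nat) = \<one>" using yc(1) r_inv[OF yc(1)] by (simp add: numeral_2_eq_2)
      then have "ord y dvd 2" using yc(1) by (simp add: pow_eq_id)
      moreover have "odd (ord y)" using ord_dvd_group_order[OF yc(1)] odd by (meson dvd_trans)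
      ultimately have "ord y = 1" by (metis prime_nat_iff two_is_prime_nat dvd_refl)
      then show False using ord_eq_1[OF yc(1)] yc(3) by simp
    qed
  qed
  moreover have "card (nilpotentizer G x) = Suc (card (nilpotentizer G x - {\<one>}))"
    by (rule card.remove[OF finN one])
  ultimately show ?thesis by simp
qed

section \<open>Degrees in a self-complementary nilpotent graph\<close>

text \<open>The order of \<open>x\<close> divides \<open>|G| + 2\<close> and \<open>|G|\<close>, so \<open>x\<close> is an involution and its nilpotentizer has even
size; therefore 4 divides \<open>|G| + 2\<close> and not \<open>|G|\<close>. This makes the nilpotentizer a subgroup, namely the
centralizer of \<open>x\<close>, whose index is less than 2.\<close>

lemma no_nilpotentizer_of_half_size:
  assumes fin: "finite (carrier G)"
    and x: "x \<in> carrier G" "x \<noteq> \<one>" "x \<notin> nil G"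
  shows "2 * card (nilpotentizer G x) \<noteq> order G + 2"
proof
  let ?N = "nilpotentizer G x"
  assume half: "2 * card ?N = order G + 2"
  have dvd: "ord x dvd card ?N" by (rule ord_dvd_card_nilpotentizer[OF fin x(1)])
  then have "ord x dvd order G + 2" unfolding half[symmetric] by simp
  then have "ord x dvd 2" using dvd_add_right_iff[OF ord_dvd_group_order[OF x(1)]] by blast
  moreover have "ord x \<noteq> 1" using ord_eq_1[OF x(1)] x(2) by simp
  ultimately have ord: "ord x = 2" by (metis prime_nat_iff two_is_prime_nat)
  have "4 dvd order G + 2" using dvd half unfolding ord by presburger
  then have no4: "\<not> 4 dvd order G" by presburger
  have N: "?N = centralizer G {x}"
  proof
    show "?N \<subseteq> centralizer G {x}"
      using involution_commutes_if_generates_nilpotent[OF fin no4 x(1) ord]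
      by (auto simp: nilpotentizer_def centralizer_def)
    show "centralizer G {x} \<subseteq> ?N"
      using x(1) generates_nilpotent_if_commute[of x] by (auto simp: nilpotentizer_def centralizer_def)
  qed
  have C: "subgroup (centralizer G {x}) G" by (rule subgroup_centralizer) (use x(1) in simp)
  obtain k where k: "order G = k * card ?N" using lagrange[OF C] unfolding N by metis
  have pos: "order G > 0" using fin order_gt_0_iff_finite by simp
  have "k = 1"
  proof (rule ccontr)
    assume "k \<noteq> 1"
    moreover have "k \<noteq> 0" using k pos by auto
    ultimately have "2 * card ?N \<le> k * card ?N" by (intro mult_le_mono1) simp
    then show False using half k by simp
  qed
  then have "card ?N = card (carrier G)" using k by (simp add: order_def)
  then have "?N = carrier G" using card_subset_eq[OF fin, of ?N] by (auto simp: nilpotentizer_def)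
  then have "x \<in> nil G" using x(1) by (auto simp: nil_iff nilpotentizer_def)
  then show False using x(3) by contradiction
qed

text \<open>The nilpotentizer of a vertex consists of its neighbours, the vertex itself and \<open>nil G\<close>; the
isomorphism maps the neighbours of \<open>x\<close> onto the vertices other than \<open>f x\<close> that are not neighbours of
\<open>f x\<close>.\<close>

lemma self_complementary_card_nilpotentizer_sum:
  assumes fin: "finite (carrier G)" and sc: "self_complementary (nilpotent_graph G)"
  obtains f where "bij_betw f (carrier G - nil G) (carrier G - nil G)"
    and "\<And>x. x \<in> carrier G - nil G \<Longrightarrow>
      card (nilpotentizer G x) + card (nilpotentizer G (f x)) = order G + card (nil G) + 1"
proof -
  let ?\<Gamma> = "nilpotent_graph G" and ?N = "nilpotentizer G"
  define V where "V = carrier G - nil G"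
  have finV: "finite V" using fin by (simp add: V_def)
  have nil_sub: "nil G \<subseteq> carrier G" by (auto simp: nil_iff)
  have finnil: "finite (nil G)" using fin nil_sub by (rule finite_subset[rotated])
  obtain f where bij: "bij_betw f V V"
    and arcs: "\<And>x y. x \<in> V \<Longrightarrow> y \<in> V \<Longrightarrow>
      (x, y) \<in> parcs ?\<Gamma> \<longleftrightarrow> (f x, f y) \<in> parcs (graph_complement ?\<Gamma>)"
    using sc pair_graph_nilpotent_graph[OF fin] pair_graph_graph_complement[OF pair_graph_nilpotent_graph[OF fin]]
    by (auto simp: self_complementary_def digraph_iso_with_proj_iff V_def nilpotent_graph_def graph_complement_def)
  have fV: "f x \<in> V" if "x \<in> V" for x using bij that by (auto simp: bij_betw_def)
  have inj: "f x = f y \<longleftrightarrow> x = y" if "x \<in> V" "y \<in> V" for x y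
    using bij that by (auto simp: bij_betw_def inj_on_def)
  have flip: "generates_nilpotent G x y \<longleftrightarrow> \<not> generates_nilpotent G (f x) (f y)"
    if "x \<in> V" "y \<in> V" "x \<noteq> y" for x y
    using arcs[OF that(1,2)] that fV inj[OF that(1,2)]
    by (auto simp: nilpotent_graph_def graph_complement_def simp flip: V_def)
  define A where "A x = {y \<in> V. y \<noteq> x \<and> generates_nilpotent G x y}" for x
  have finA: "finite (A x)" for x using finV by (simp add: A_def)
  have N_card: "card (?N x) = card (A x) + 1 + card (nil G)" if x: "x \<in> V" for x
  proof -
    have "generates_nilpotent G x y" if "y \<in> nil G" for y
      using that x generates_nilpotent_commute[of x y] by (simp add: V_def nil_iff)
    moreover have "generates_nilpotent G x x" "x \<in> carrier G"
      using x generates_nilpotent_if_commute[of x x] by (simp_all add: V_def)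
    ultimately have "?N x = insert x (A x) \<union> nil G"
      using nil_sub unfolding nilpotentizer_def A_def V_def by blast
    moreover have "x \<notin> A x" "insert x (A x) \<inter> nil G = {}" using x by (auto simp: A_def V_def)
    ultimately show ?thesis using finA finnil by (simp add: card_Un_disjoint)
  qed
  have V_card: "card V + card (nil G) = order G"
    unfolding V_def order_def using card_Diff_subset[OF finnil nil_sub] card_mono[OF fin nil_sub] by simp
  have degrees: "card (A x) + card (A (f x)) + 1 = card V" if x: "x \<in> V" for x
  proof -
    have "f ` A x = V - insert (f x) (A (f x))"
    proof
      show "f ` A x \<subseteq> V - insert (f x) (A (f x))"
      proof (rule image_subsetI)
        fix y assume "y \<in> A x"
        then have y: "y \<in> V" "y \<noteq> x" "generates_nilpotent G x y" by (simp_all add: A_def)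
        then show "f y \<in> V - insert (f x) (A (f x))"
          using flip[OF x y(1)] fV[OF y(1)] inj[OF y(1) x] by (simp add: A_def)
      qed
      show "V - insert (f x) (A (f x)) \<subseteq> f ` A x"
      proof
        fix z assume z: "z \<in> V - insert (f x) (A (f x))"
        then obtain y where y: "y \<in> V" "z = f y" using bij by (auto simp: bij_betw_def)
        then show "z \<in> f ` A x" using z x flip[OF x y(1)] by (auto simp: A_def)
      qed
    qed
    moreover have "card (f ` A x) = card (A x)"
      by (rule card_image) (use bij in \<open>auto simp: bij_betw_def A_def intro: inj_on_subset\<close>)
    moreover have "insert (f x) (A (f x)) \<subseteq> V" using fV[OF x] by (auto simp: A_def)
    moreover have "card (insert (f x) (A (f x))) = Suc (card (A (f x)))"
      using finA by (simp add: A_def)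
    ultimately show ?thesis
      using card_Diff_subset[of "insert (f x) (A (f x))" V] card_mono[OF finV, of "insert (f x) (A (f x))"] finA
      by simp
  qed
  have sum: "card (?N x) + card (?N (f x)) = order G + card (nil G) + 1" if "x \<in> V" for x
    using N_card[OF that] N_card[OF fV[OF that]] degrees[OF that] V_card by simp
  show ?thesis by (rule that) (use bij sum in \<open>simp_all add: V_def\<close>)
qed

end

theorem theorem4p11:
  fixes G :: "('a, 'b) monoid_scheme"
  assumes "group G" and "finite (carrier G)" and "\<not> nilpotent_group G"
  shows "\<not> self_complementary (nilpotent_graph G)"
proof
  interpret group G by (rule assms(1))
  note fin = assms(2)
  let ?N = "nilpotentizer G"
  define V where "V = carrier G - nil G"
  have nil_sub: "nil G \<subseteq> carrier G" by (auto simp: nil_iff)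
  have "nil G \<noteq> carrier G" using nilpotent_group_if_nil_eq_carrier[OF fin] assms(3) by blast
  then obtain v where v: "v \<in> V" using nil_sub unfolding V_def by blast
  assume sc: "self_complementary (nilpotent_graph G)"
  obtain f where bij: "bij_betw f V V" and sum: "\<And>x. x \<in> V \<Longrightarrow>
      card (?N x) + card (?N (f x)) = order G + card (nil G) + 1"
    unfolding V_def by (rule self_complementary_card_nilpotentizer_sum[OF fin sc]) blast
  have fV: "f x \<in> V" if "x \<in> V" for x using bij that by (auto simp: bij_betw_def)
  have finV: "finite V" using fin by (simp add: V_def)
  have vc: "x \<in> carrier G" if "x \<in> V" for x using that by (simp add: V_def)
  have nil_trivial: "nil G = {\<one>\<^bsub>G\<^esub>}"
  proof (rule ccontr)
    have "\<one>\<^bsub>G\<^esub> \<in> nil G" using generates_nilpotent_if_commute[of "\<one>\<^bsub>G\<^esub>"] by (simp add: nil_iff)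
    moreover assume "nil G \<noteq> {\<one>\<^bsub>G\<^esub>}"
    ultimately obtain a where "a \<in> nil G" "a \<noteq> \<one>\<^bsub>G\<^esub>" by blast
    then obtain c where c: "c \<in> center G" "c \<noteq> \<one>\<^bsub>G\<^esub>" by (rule center_nontrivial_if_nil_nontrivial[OF fin])
    have cc: "c \<in> carrier G" using c(1) by (simp add: centralizer_def)
    have "ord c dvd card (?N v) + card (?N (f v))"
      using ord_central_dvd_card_nilpotentizer[OF fin _ c(1)] vc v fV by simp
    moreover have "ord c dvd order G + card (nil G)"
      using ord_dvd_group_order[OF cc] ord_central_dvd_card_nil[OF fin c(1)] by simp
    ultimately have "ord c dvd 1" unfolding sum[OF v] using dvd_add_right_iff by blast
    then show False using c(2) ord_eq_1[OF cc] by simp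
  qed
  show False
  proof (cases "even (order G)")
    case False
    have "odd (card (?N v))" "odd (card (?N (f v)))"
      using odd_card_nilpotentizer[OF fin False] vc v fV by simp_all
    then show False using sum[OF v] False nil_trivial by simp presburger
  next
    case True
    have "even (card V)"
    proof (rule even_card_if_values_complementary[OF finV])
      show "inj_on f V" "f ` V \<subseteq> V" using bij by (simp_all add: bij_betw_def)
      show "card (?N x) + card (?N (f x)) = order G + 2" if "x \<in> V" for x
        using sum[OF that] nil_trivial by simp
      show "2 * card (?N x) \<noteq> order G + 2" if x: "x \<in> V" for x
        by (rule no_nilpotentizer_of_half_size[OF fin]) (use x nil_trivial in \<open>simp_all add: V_def\<close>)
    qed
    moreover have "card V = order G - 1"
      using card_Diff_subset[OF _ nil_sub] by (simp add: V_def order_def nil_trivial)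
    moreover have "order G > 0" using fin order_gt_0_iff_finite by simp
    ultimately show False using True by simp
  qed
qed

end
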